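(* Assume: (A1) the solution set $S_1$ of the variational inequality is nonempty; (A2) $F$ is monotone, i.e. $\langle F(x)-F(y),x-y\rangle\ge 0$ for all $x,y\in K$; (A3) $F$ has a stochastic oracle $F_\xi$ that is variable $\bar L$-Lipschitz in mean; (A4) $F$ is $L$-Lipschitz continuous, i.e. $\|F(x)-F(y)\|_*\le L\|x-y\|$ for all $x,y\in K$. Let $\{x_s\}$ be generated by the algorithm with $p\in(0,1)$, $\gamma\in(p,1)$ and $$\alpha\le\min\left\{\frac{\gamma-p}{2(1-p)},\ \frac{(1-\gamma)b}{(1-p)(2\bar L^2+bL^2)}\right\}.$$ Then for every $S\ge1$, with $z^S=\frac1S\sum_{s=0}^{S-1}x_{s+1}$, $$\mathbb E\left[\mathrm{Gap}(z^S)\right]\le\frac{2+\alpha-\gamma}{\alpha S}\max_{u\in C}D(u,x_0),$$ where $C$ is a compact subset of $K$ and $\mathrm{Gap}(z)=\max_{u\in C}\{\langle F(u),z-u\rangle+g(z)-g(u)\}$.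
   Context: Setting. $\mathcal X$ is a finite-dimensional space with inner product $\langle\cdot,\cdot\rangle$ and a norm $\|\cdot\|$ with dual norm $\|\cdot\|_*$. $K\subset\mathcal X$ is nonempty, closed and convex; $g:K\to(-\infty,+\infty]$ is proper, convex, lower semicontinuous; $F:\mathrm{dom}\,g\to\mathcal X$ is an operator of the form $F=\frac1M\sum_{i=1}^M F_i$. The variational inequality is: find $x^*\in K$ with $\langle F(x^* ),y-x^*\rangle+g(y)-g(x^* )\ge 0$ for all $y\in K$; $S_1$ is its solution set. Bregman distance. $f:K\to(-\infty,+\infty]$ is proper, convex, lower semicontinuous, $\mathrm{dom}\,g\subset\mathrm{dom}\,f$, $f$ is differentiable on $\mathrm{dom}(\partial f)=\{x\in\mathrm{dom} f:\partial f(x)\ne\emptyset\}$ and 1-strongly convex: $f(x)\ge f(y)+\langle\nabla f(y),x-y\rangle+\frac12\|x-y\|^2$ for $x\in\mathrm{dom} f$, $y\in\mathrm{dom}(\partial f)$. $D(x,y)=f(x)-f(y)-\langle\nabla f(y),x-y\rangle$ for $x\in\mathrm{dom}\,g$, $y\in\mathrm{dom}(\partial f)$. Stochastic oracle. $F$ has a stochastic oracle $F_\xi$ that is variable $\bar L$-Lipschitz in mean if for any $x,y\in\mathrm{dom}\,g$ there is a distribution $Q_{x,y}$ of $\xi$ such that (i) $F(z)=\mathbb E_{\xi\sim Q_{x,y}}[F_\xi(z)]$ for all $z\in\mathrm{dom}\,g$; (ii) $\mathbb E_{\xi\sim Q_{x,y}}[\|F_\xi(x)-F_\xi(y)\|_*^2]\le\bar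 L^2\|x-y\|^2$. Algorithm. Parameters: $0<\gamma\le1$, $0<p\le1$, stepsize $\alpha>0$, batch size $b\in\{1,\dots,M\}$. Start with $x_0=x_{-1}=w_0=w_{-1}\in K$. For $s=0,1,\dots,S-1$: draw $\xi^s_1,\dots,\xi^s_b\in\{1,\dots,M\}$ independently from $Q_{x_s,w_{s-1}}$ and set $B^s=\{\xi_1^s,\dots,\xi_b^s\}$ (with multiplicity); set $\bar x_s=(\nabla f)^{-1}\big(\gamma\nabla f(x_s)+(1-\gamma)\nabla f(x_{s-1})\big)$; $\Delta^s=\frac1b\sum_{\xi\in B^s}\big(F(w_s)+F_\xi(x_s)-F_\xi(w_{s-1})\big)$; $x_{s+1}=\arg\min_{x\in K}\{\alpha g(x)+\langle\alpha\Delta^s,x\rangle+D(x,\bar x_s)\}$; and let $w_{s+1}=x_{s+1}$ with probability $p$ and $w_{s+1}=x_s$ with probability $1-p$ (fresh independent coin). All iterates are assumed well defined, i.e. the points used as second arguments of $D$ lie in $\mathrm{dom}(\partial f)$. *)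

theory Defs
  imports "HOL-Probability.Probability"
begin

section \<open>Norms\<close>

text \<open>The type class \<open>euclidean_space\<close> supplies the inner product. The norm of the statement
  is an arbitrary one and need not be induced by that inner product.\<close>

definition is_norm :: "('a::real_vector \<Rightarrow> real) \<Rightarrow> bool" where
  "is_norm N \<longleftrightarrow>
     (\<forall>x. N x = 0 \<longleftrightarrow> x = 0) \<and>
     (\<forall>c x. N (c *\<^sub>R x) = \<bar>c\<bar> * N x) \<and>
     (\<forall>x y. N (x + y) \<le> N x + N y)"

definition dual_norm :: "('a::real_inner \<Rightarrow> real) \<Rightarrow> 'a \<Rightarrow> real" where
  "dual_norm N v = (SUP x\<in>{x. N x \<le> 1}. v \<bullet> x)"


section \<open>Extended-valued convex functions on a set\<close>

text \<open>A function \<open>K \<rightarrow> (-\<infinity>, \<infinity>]\<close> is a total function into \<open>ereal\<close> of which only the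
  values on \<open>K\<close> matter.\<close>

definition edom :: "'a set \<Rightarrow> ('a \<Rightarrow> ereal) \<Rightarrow> 'a set" where
  "edom K h = {x \<in> K. h x < \<infinity>}"

definition proper_on :: "'a set \<Rightarrow> ('a \<Rightarrow> ereal) \<Rightarrow> bool" where
  "proper_on K h \<longleftrightarrow> (\<forall>x\<in>K. h x \<noteq> - \<infinity>) \<and> edom K h \<noteq> {}"

definition ereal_convex_on :: "'a::real_vector set \<Rightarrow> ('a \<Rightarrow> ereal) \<Rightarrow> bool" where
  "ereal_convex_on K h \<longleftrightarrow>
     (\<forall>x\<in>K. \<forall>y\<in>K. \<forall>t\<in>{0..1}.
        h ((1 - t) *\<^sub>R x + t *\<^sub>R y) \<le> ereal (1 - t) * h x + ereal t * h y)"

definition lsc_on :: "'a::topological_space set \<Rightarrow> ('a \<Rightarrow> ereal) \<Rightarrow> bool" where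
  "lsc_on K h \<longleftrightarrow> (\<forall>x\<in>K. h x \<le> Liminf (at x within K) h)"

definition subdiff :: "'a::real_inner set \<Rightarrow> ('a \<Rightarrow> ereal) \<Rightarrow> 'a \<Rightarrow> 'a set" where
  "subdiff K h x = {v. \<forall>y\<in>K. h x + ereal (v \<bullet> (y - x)) \<le> h y}"

definition dom_subdiff :: "'a::real_inner set \<Rightarrow> ('a \<Rightarrow> ereal) \<Rightarrow> 'a set" where
  "dom_subdiff K h = {x \<in> edom K h. subdiff K h x \<noteq> {}}"


section \<open>Bregman distance\<close>

text \<open>\<open>f\<close> is only defined on \<open>K\<close>, so differentiability is taken relative to \<open>dom f\<close>: the
  derivative of \<open>f\<close> at \<open>y\<close> within \<open>dom f\<close> is \<open>\<langle>\<nabla>f y, \<cdot>\<rangle>\<close>. At an interior point of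
  \<open>dom f\<close> this is ordinary differentiability and determines \<open>\<nabla>f y\<close>; if \<open>dom f\<close> has empty
  interior (entropy on a simplex), \<open>\<nabla>f\<close> is a chosen representative.\<close>

definition gradient_on ::
  "'a::real_inner set \<Rightarrow> ('a \<Rightarrow> ereal) \<Rightarrow> ('a \<Rightarrow> 'a) \<Rightarrow> 'a set \<Rightarrow> bool" where
  "gradient_on K f gradf A \<longleftrightarrow>
     (\<forall>y\<in>A. ((\<lambda>x. real_of_ereal (f x)) has_derivative (\<lambda>h. gradf y \<bullet> h))
              (at y within edom K f))"

definition strongly_convex1 ::
  "('a::real_inner \<Rightarrow> real) \<Rightarrow> 'a set \<Rightarrow> ('a \<Rightarrow> ereal) \<Rightarrow> ('a \<Rightarrow> 'a) \<Rightarrow> bool" where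
  "strongly_convex1 N K f gradf \<longleftrightarrow>
     (\<forall>x\<in>edom K f. \<forall>y\<in>dom_subdiff K f.
        f y + ereal (gradf y \<bullet> (x - y)) + ereal ((N (x - y))\<^sup>2 / 2) \<le> f x)"

definition bregman ::
  "('a::real_inner \<Rightarrow> ereal) \<Rightarrow> ('a \<Rightarrow> 'a) \<Rightarrow> 'a \<Rightarrow> 'a \<Rightarrow> ereal" where
  "bregman f gradf x y = f x - f y - ereal (gradf y \<bullet> (x - y))"


section \<open>The variational inequality and the operator\<close>

text \<open>\<open>F\<close> is an operator on \<open>dom g\<close>; a total function is used, and its values outside
  \<open>dom g\<close> are left unconstrained.\<close>

definition vi_solutions ::
  "'a::real_inner set \<Rightarrow> ('a \<Rightarrow> ereal) \<Rightarrow> ('a \<Rightarrow> 'a) \<Rightarrow> 'a set" where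
  "vi_solutions K g F =
     {x \<in> edom K g. \<forall>y\<in>K. 0 \<le> ereal (F x \<bullet> (y - x)) + g y - g x}"

definition monotone_operator_on :: "'a::real_inner set \<Rightarrow> ('a \<Rightarrow> 'a) \<Rightarrow> bool" where
  "monotone_operator_on A F \<longleftrightarrow> (\<forall>x\<in>A. \<forall>y\<in>A. 0 \<le> (F x - F y) \<bullet> (x - y))"

definition operator_lipschitz_on ::
  "('a::real_inner \<Rightarrow> real) \<Rightarrow> real \<Rightarrow> 'a set \<Rightarrow> ('a \<Rightarrow> 'a) \<Rightarrow> bool" where
  "operator_lipschitz_on N L A F \<longleftrightarrow>
     (\<forall>x\<in>A. \<forall>y\<in>A. dual_norm N (F x - F y) \<le> L * N (x - y))"

text \<open>\<open>Fxi\<close> is the oracle and \<open>Q x y\<close> the distribution of the index attached to \<open>x\<close>, \<open>y\<close>.\<close>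

definition variable_lipschitz_oracle ::
  "('a::euclidean_space \<Rightarrow> real) \<Rightarrow> real \<Rightarrow> 'a set \<Rightarrow> nat \<Rightarrow> ('a \<Rightarrow> 'a) \<Rightarrow> (nat \<Rightarrow> 'a \<Rightarrow> 'a)
     \<Rightarrow> ('a \<Rightarrow> 'a \<Rightarrow> nat pmf) \<Rightarrow> bool" where
  "variable_lipschitz_oracle N Lbar A M F Fxi Q \<longleftrightarrow>
     (\<forall>x\<in>A. \<forall>y\<in>A.
        set_pmf (Q x y) \<subseteq> {1..M} \<and>
        (\<forall>z\<in>A. F z = measure_pmf.expectation (Q x y) (\<lambda>\<xi>. Fxi \<xi> z)) \<and>
        measure_pmf.expectation (Q x y) (\<lambda>\<xi>. (dual_norm N (Fxi \<xi> x - Fxi \<xi> y))\<^sup>2)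
          \<le> Lbar\<^sup>2 * (N (x - y))\<^sup>2)"


section \<open>The algorithm\<close>

definition mirror_mean ::
  "'a::real_inner set \<Rightarrow> ('a \<Rightarrow> ereal) \<Rightarrow> ('a \<Rightarrow> 'a) \<Rightarrow> real \<Rightarrow> 'a \<Rightarrow> 'a \<Rightarrow> 'a" where
  "mirror_mean K f gradf \<gamma> x x' =
     inv_into (dom_subdiff K f) gradf (\<gamma> *\<^sub>R gradf x + (1 - \<gamma>) *\<^sub>R gradf x')"

definition batch_direction ::
  "('a::real_vector \<Rightarrow> 'a) \<Rightarrow> (nat \<Rightarrow> 'a \<Rightarrow> 'a) \<Rightarrow> nat \<Rightarrow> nat list \<Rightarrow> 'a \<Rightarrow> 'a \<Rightarrow> 'a \<Rightarrow> 'a" where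
  "batch_direction F Fxi b B x w w' =
     (1 / real b) *\<^sub>R (\<Sum>\<xi>\<leftarrow>B. F w + Fxi \<xi> x - Fxi \<xi> w')"

definition prox_step ::
  "'a::real_inner set \<Rightarrow> ('a \<Rightarrow> ereal) \<Rightarrow> ('a \<Rightarrow> 'a) \<Rightarrow> ('a \<Rightarrow> ereal) \<Rightarrow> real \<Rightarrow> 'a \<Rightarrow> 'a \<Rightarrow> 'a" where
  "prox_step K f gradf g \<alpha> \<Delta> xbar =
     arg_min_on (\<lambda>x. ereal \<alpha> * g x + ereal ((\<alpha> *\<^sub>R \<Delta>) \<bullet> x) + bregman f gradf x xbar) K"

text \<open>Joint law of the sequences \<open>x\<close> and \<open>w\<close> after \<open>s\<close> iterations. They are indexed by
  integers so that the index \<open>-1\<close> is available. After \<open>s\<close> iterations only the entries with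
  index in \<open>{-1..s}\<close> are meaningful.\<close>

primrec algorithm_law ::
  "'a::euclidean_space set \<Rightarrow> ('a \<Rightarrow> ereal) \<Rightarrow> ('a \<Rightarrow> 'a) \<Rightarrow> ('a \<Rightarrow> ereal) \<Rightarrow> ('a \<Rightarrow> 'a)
     \<Rightarrow> (nat \<Rightarrow> 'a \<Rightarrow> 'a) \<Rightarrow> ('a \<Rightarrow> 'a \<Rightarrow> nat pmf) \<Rightarrow> real \<Rightarrow> real \<Rightarrow> real \<Rightarrow> nat \<Rightarrow> 'a
     \<Rightarrow> nat \<Rightarrow> ((int \<Rightarrow> 'a) \<times> (int \<Rightarrow> 'a)) pmf" where
  "algorithm_law K f gradf g F Fxi Q \<gamma> p \<alpha> b x0 0 = return_pmf (\<lambda>_. x0, \<lambda>_. x0)"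
| "algorithm_law K f gradf g F Fxi Q \<gamma> p \<alpha> b x0 (Suc s) =
     bind_pmf (algorithm_law K f gradf g F Fxi Q \<gamma> p \<alpha> b x0 s) (\<lambda>(x, w).
     bind_pmf (replicate_pmf b (Q (x (int s)) (w (int s - 1)))) (\<lambda>B.
     bind_pmf (bernoulli_pmf p) (\<lambda>coin.
       let xbar = mirror_mean K f gradf \<gamma> (x (int s)) (x (int s - 1));
           \<Delta> = batch_direction F Fxi b B (x (int s)) (w (int s)) (w (int s - 1));
           xnew = prox_step K f gradf g \<alpha> \<Delta> xbar;
           wnew = (if coin then xnew else x (int s))
       in return_pmf (x(int s + 1 := xnew), w(int s + 1 := wnew)))))"

text \<open>The first \<open>S\<close> iterations are well defined: every \<open>x\<^sub>s\<close> with \<open>s \<le> S\<close> lies in the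
  domain of the subdifferential, and for \<open>s < S\<close> the mirror average has a preimage
  in that domain under the gradient, so that \<^const>\<open>mirror_mean\<close> is that preimage.\<close>

definition iterates_well_defined ::
  "'a::real_inner set \<Rightarrow> ('a \<Rightarrow> ereal) \<Rightarrow> ('a \<Rightarrow> 'a) \<Rightarrow> real
     \<Rightarrow> (nat \<Rightarrow> ((int \<Rightarrow> 'a) \<times> (int \<Rightarrow> 'a)) pmf) \<Rightarrow> nat \<Rightarrow> bool" where
  "iterates_well_defined K f gradf \<gamma> law S \<longleftrightarrow>
     (\<forall>s\<le>S. \<forall>(x, w)\<in>set_pmf (law s). x (int s) \<in> dom_subdiff K f) \<and>
     (\<forall>s<S. \<forall>(x, w)\<in>set_pmf (law s).
        \<gamma> *\<^sub>R gradf (x (int s)) + (1 - \<gamma>) *\<^sub>R gradf (x (int s - 1)) \<in> gradf ` dom_subdiff K f)"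

definition average_iterate :: "(int \<Rightarrow> 'a::real_vector) \<Rightarrow> nat \<Rightarrow> 'a" where
  "average_iterate x S = (1 / real S) *\<^sub>R (\<Sum>s<S. x (int s + 1))"


section \<open>Gap function\<close>

text \<open>\<open>F u\<close> and \<open>D(u, x\<^sub>0)\<close> only make sense for \<open>u\<close> in \<open>dom g\<close>, so test points outside
  \<open>dom g\<close> (at which \<open>- g u = -\<infinity>\<close>) are left out.\<close>

definition Gap ::
  "'a::real_inner set \<Rightarrow> ('a \<Rightarrow> ereal) \<Rightarrow> ('a \<Rightarrow> 'a) \<Rightarrow> 'a set \<Rightarrow> 'a \<Rightarrow> ereal" where
  "Gap K g F C z = (SUP u\<in>C \<inter> edom K g. ereal (F u \<bullet> (z - u)) + g z - g u)"

end

theory Submission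
  imports Defs
begin

text \<open>
  Write \<open>x = x\<^sub>s\<close>, \<open>x' = x\<^sub>s\<^sub>-\<^sub>1\<close>, \<open>w' = w\<^sub>s\<^sub>-\<^sub>1\<close>, \<open>X = x\<^sub>s\<^sub>+\<^sub>1\<close>, let \<open>a = F x - F w'\<close> and let \<open>A\<close> be its
  unbiased batch estimate. The optimality condition of the proximal step and monotonicity of \<open>F\<close>
  give, for every \<open>u\<close> in the domain of \<open>g\<close>, a bound on
  \<open>\<alpha> (\<langle>F u, X - u\<rangle> + g X - g u)\<close> that consists of telescoping terms, the noise term
  \<open>\<alpha> \<langle>A - a, u - x\<rangle>\<close>, the cross term \<open>- \<alpha> \<langle>A, X - x\<rangle>\<close> and the negative terms
  \<open>- \<gamma> D(X, x) - (1 - \<gamma>) D(X, x')\<close> (\<open>step_inequality\<close>). The telescoping terms leave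
  \<open>(2 - \<gamma>) D(u, x\<^sub>0)\<close>. It remains to see that the noise costs another \<open>\<alpha> D(u, x\<^sub>0)\<close> and that
  everything else is nonpositive in expectation.

  The point \<open>u\<close> is chosen after all random draws, hence the noise cannot simply be averaged
  against it. Fenchel's inequality separates the two:
  \<open>\<langle>Z, u - x\<^sub>0\<rangle> \<le> D(u, x\<^sub>0) + D\<^sup>*(Z)\<close> for the accumulated noise \<open>Z\<close>, where \<open>D\<^sup>*\<close> is the
  conjugate of \<open>D(\<cdot>, x\<^sub>0)\<close>. Strong convexity makes \<open>D\<^sup>*\<close> smooth for the dual norm, so one
  batch raises its expectation by at most half the second moment of one sample divided by \<open>b\<close>
  (\<open>breg_conj_mean_batch\<close>). This reduction by \<open>b\<close> is a property of the conjugate; the dual norm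
  itself need not show it. The conjugate based at \<open>x\<close> treats the cross term in the same way, at
  the price of \<open>\<theta> D(X, x)\<close> with \<open>\<theta> = (\<gamma> - p) / (1 - p)\<close>. All costs then add up to
  \<open>(\<kappa> / 2) \<parallel>x - w'\<parallel>\<^sup>2\<close> (\<open>expected_step_le\<close>).

  These costs are paid by the negative terms of the preceding step: what is needed is that
  \<open>(\<gamma> - \<theta>) D(X, x) + (1 - \<gamma>) D(X, x') - (\<kappa> / 2) \<parallel>X - w\<parallel>\<^sup>2\<close> with \<open>w = w\<^sub>s\<close> has nonnegative
  expectation (\<open>expected_surplus_nonneg\<close>). If \<open>X\<close> were independent of the coin that decides
  whether \<open>w\<close> is \<open>x\<close> or \<open>x'\<close>, this would follow from \<open>\<gamma> - \<theta> = p (1 - \<theta>)\<close>,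
  \<open>1 - \<gamma> = (1 - p) (1 - \<theta>)\<close> and \<open>\<kappa> \<le> 1 - \<theta>\<close>. But \<open>X\<close> depends on \<open>w\<close> through \<open>F w\<close>.
  Nonexpansiveness of the proximal map bounds the distance of the two possible values of \<open>X\<close> by
  \<open>c \<parallel>x - x'\<parallel>\<close> with \<open>c = \<alpha> L\<close> (\<open>new_point_contraction\<close>), and the stepsize leaves
  enough room for this: \<open>\<kappa> \<le> (1 - \<theta>) (1 - \<rho>)\<close> with \<open>\<rho> = 1/4 + 2 c\<^sup>2\<close>, while the dependence costs a
  fraction \<open>2 c / (1 + c)\<^sup>2 \<le> \<rho>\<close> (\<open>coin_average_nonneg\<close>).
\<close>

section \<open>Norms and their duals\<close>

lemma is_norm_zero: "is_norm N \<Longrightarrow> N 0 = 0"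
  by (simp add: is_norm_def)

lemma is_norm_scaleR: "is_norm N \<Longrightarrow> N (c *\<^sub>R x) = \<bar>c\<bar> * N x"
  by (simp add: is_norm_def)

lemma is_norm_triangle: "is_norm N \<Longrightarrow> N (x + y) \<le> N x + N y"
  by (simp add: is_norm_def)

lemma is_norm_minus: "is_norm N \<Longrightarrow> N (- x) = N x"
  using is_norm_scaleR[of N "-1" x] by simp

lemma is_norm_minus_commute: "is_norm N \<Longrightarrow> N (x - y) = N (y - x)"
  using is_norm_minus[of N "x - y"] by simp

lemma is_norm_nonneg: "is_norm N \<Longrightarrow> 0 \<le> N x"
  using is_norm_triangle[of N x "- x"] is_norm_minus[of N x] is_norm_zero[of N] by simp

lemma is_norm_pos: "is_norm N \<Longrightarrow> x \<noteq> 0 \<Longrightarrow> 0 < N x"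
  using is_norm_nonneg[of N x] by (auto simp: is_norm_def less_le)

lemma is_norm_triangle_diff: "is_norm N \<Longrightarrow> N (x - z) \<le> N (x - y) + N (y - z)"
  using is_norm_triangle[of N "x - y" "y - z"] by simp

lemma is_norm_dominates_norm:
  fixes N :: "'a::euclidean_space \<Rightarrow> real"
  assumes "is_norm N"
  obtains m where "0 < m" "\<And>x. m * norm x \<le> N x"
proof -
  have "convex_on UNIV N"
  proof (rule convex_onI)
    fix t :: real and x y :: 'a assume "0 < t" "t < 1"
    then show "N ((1 - t) *\<^sub>R x + t *\<^sub>R y) \<le> (1 - t) * N x + t * N y"
      using is_norm_triangle[OF assms, of "(1 - t) *\<^sub>R x" "t *\<^sub>R y"]
      by (simp add: is_norm_scaleR[OF assms])
  qed simp
  then have "continuous_on (sphere 0 1) N"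
    using convex_on_continuous[of UNIV N] continuous_on_subset by blast
  moreover have "compact (sphere (0::'a) 1)" "sphere (0::'a) 1 \<noteq> {}"
    by auto
  ultimately obtain e where e: "e \<in> sphere 0 1" "\<And>y. y \<in> sphere 0 1 \<Longrightarrow> N e \<le> N y"
    using continuous_attains_inf[of "sphere 0 1" N] by blast
  show thesis
  proof (rule that[of "N e"])
    show "0 < N e"
      using e(1) by (intro is_norm_pos[OF assms]) auto
    fix x show "N e * norm x \<le> N x"
    proof (cases "x = 0")
      case False
      then have "N e \<le> N ((1 / norm x) *\<^sub>R x)"
        by (intro e(2)) simp
      also have "\<dots> = N x / norm x"
        by (simp add: is_norm_scaleR[OF assms])
      finally show ?thesis
        using False by (simp add: field_simps)
    qed (simp add: is_norm_zero[OF assms])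
  qed
qed

lemma bdd_above_dual_norm:
  fixes N :: "'a::euclidean_space \<Rightarrow> real"
  assumes "is_norm N"
  shows "bdd_above ((\<lambda>x. v \<bullet> x) ` {x. N x \<le> 1})"
proof -
  obtain m where m: "0 < m" "\<And>x. m * norm x \<le> N x"
    using is_norm_dominates_norm[OF assms] by blast
  show ?thesis
  proof (rule bdd_aboveI2)
    fix x assume "x \<in> {x. N x \<le> 1}"
    then have "norm x \<le> 1 / m"
      using m(2)[of x] m(1) by (simp add: field_simps)
    then have "norm v * norm x \<le> norm v * (1 / m)"
      by (rule mult_left_mono) simp
    then show "v \<bullet> x \<le> norm v * (1 / m)"
      using norm_cauchy_schwarz[of v x] by linarith
  qed
qed

lemma inner_le_dual_norm:
  fixes N :: "'a::euclidean_space \<Rightarrow> real"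
  assumes "is_norm N"
  shows "v \<bullet> x \<le> dual_norm N v * N x"
proof (cases "x = 0")
  case False
  then have pos: "0 < N x"
    by (rule is_norm_pos[OF assms])
  have "v \<bullet> ((1 / N x) *\<^sub>R x) \<le> dual_norm N v"
    unfolding dual_norm_def
    by (rule cSUP_upper[OF _ bdd_above_dual_norm[OF assms]])
      (use pos in \<open>simp add: is_norm_scaleR[OF assms]\<close>)
  then show ?thesis
    using pos by (simp add: field_simps)
qed (simp add: is_norm_zero[OF assms])

lemma dual_norm_nonneg:
  fixes N :: "'a::euclidean_space \<Rightarrow> real"
  assumes "is_norm N"
  shows "0 \<le> dual_norm N v"
  unfolding dual_norm_def
  by (rule cSUP_upper2[OF bdd_above_dual_norm[OF assms], of 0]) (auto simp: is_norm_zero[OF assms])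

lemma abs_inner_le_dual_norm:
  fixes N :: "'a::euclidean_space \<Rightarrow> real"
  assumes "is_norm N"
  shows "\<bar>v \<bullet> x\<bar> \<le> dual_norm N v * N x"
  using inner_le_dual_norm[OF assms, of v x] inner_le_dual_norm[OF assms, of v "- x"]
  by (simp add: is_norm_minus[OF assms] abs_le_iff)

text \<open>The factor \<open>r\<close> is kept apart so that the dual norm is only taken of \<open>v\<close> itself.\<close>

lemma inner_le_half_squares:
  fixes N :: "'a::euclidean_space \<Rightarrow> real"
  assumes "is_norm N"
  shows "r * (v \<bullet> x) \<le> r\<^sup>2 * (dual_norm N v)\<^sup>2 / 2 + (N x)\<^sup>2 / 2"
proof -
  have "r * (v \<bullet> x) \<le> \<bar>r\<bar> * \<bar>v \<bullet> x\<bar>"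
    by (metis abs_ge_self abs_mult)
  also have "\<dots> \<le> \<bar>r\<bar> * (dual_norm N v * N x)"
    by (intro mult_left_mono abs_inner_le_dual_norm[OF assms]) simp
  also have "\<dots> \<le> (\<bar>r\<bar> * dual_norm N v)\<^sup>2 / 2 + (N x)\<^sup>2 / 2"
    using zero_le_power2[of "\<bar>r\<bar> * dual_norm N v - N x"] unfolding power2_diff by (simp add: algebra_simps)
  finally show ?thesis
    by (simp add: power_mult_distrib)
qed


section \<open>Minimizing extended-valued functions\<close>

text \<open>Lower semicontinuity in terms of neighbourhoods that include the point itself; in this form
  it passes to subsets, sums and positive multiples.\<close>

definition lsc_at_points :: "'a::topological_space set \<Rightarrow> ('a \<Rightarrow> ereal) \<Rightarrow> bool" where
  "lsc_at_points T h \<longleftrightarrow> (\<forall>x\<in>T. \<forall>c<h x. \<exists>U. open U \<and> x \<in> U \<and> (\<forall>y\<in>U \<inter> T. c < h y))"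

lemma lsc_on_imp_lsc_at_points:
  assumes "lsc_on K h"
  shows "lsc_at_points K h"
  unfolding lsc_at_points_def
proof (intro ballI allI impI)
  fix x c assume x: "x \<in> K" and c: "c < h x"
  have "c < Liminf (at x within K) h"
    using assms x c by (auto simp: lsc_on_def)
  then have "eventually (\<lambda>y. c < h y) (at x within K)"
    by (rule less_LiminfD)
  then obtain U where "open U" "x \<in> U" "\<forall>y\<in>U. y \<noteq> x \<longrightarrow> y \<in> K \<longrightarrow> c < h y"
    unfolding eventually_at_topological by blast
  then show "\<exists>U. open U \<and> x \<in> U \<and> (\<forall>y\<in>U \<inter> K. c < h y)"
    using c by (intro exI[of _ U]) force
qed

lemma lsc_at_points_subset:
  assumes "lsc_at_points K h" "T \<subseteq> K"
  shows "lsc_at_points T h"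
  unfolding lsc_at_points_def
proof (intro ballI allI impI)
  fix x c assume "x \<in> T" "c < h x"
  then obtain U where "open U" "x \<in> U" "\<forall>y\<in>U \<inter> K. c < h y"
    using assms unfolding lsc_at_points_def by blast
  then show "\<exists>U. open U \<and> x \<in> U \<and> (\<forall>y\<in>U \<inter> T. c < h y)"
    using assms(2) by (intro exI[of _ U]) auto
qed

lemma ereal_less_add_split:
  fixes c G H :: ereal
  assumes "c < G + H" "G \<noteq> -\<infinity>" "H \<noteq> -\<infinity>"
  obtains a b where "a < G" "b < H" "a \<noteq> -\<infinity>" "b \<noteq> -\<infinity>" "c \<le> a + b"
proof (cases "c = -\<infinity>")
  case True
  obtain a where "-\<infinity> < a" "a < G"
    using assms(2) dense[of "-\<infinity>" G] by auto
  moreover obtain b where "-\<infinity> < b" "b < H"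
    using assms(3) dense[of "-\<infinity>" H] by auto
  ultimately show ?thesis
    using that[of a b] True by auto
next
  case False
  then obtain c' where c': "c = ereal c'"
    using assms(1) by (cases c) auto
  show ?thesis
  proof (cases G)
    case (real G')
    show ?thesis
    proof (cases H)
      case (real H')
      let ?e = "(G' + H' - c') / 2"
      have "0 < ?e"
        using assms(1) \<open>G = ereal G'\<close> real c' by simp
      then show ?thesis
        using \<open>G = ereal G'\<close> real c' by (intro that[of "ereal (G' - ?e)" "ereal (H' - ?e)"]) (auto simp: field_simps)
    next
      case PInf
      then show ?thesis
        using \<open>G = ereal G'\<close> c' by (intro that[of "ereal (G' - 1)" "ereal (c' - G' + 1)"]) auto
    qed (use assms in auto)
  next
    case PInf
    show ?thesis
    proof (cases H)
      case (real H')
      then show ?thesis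
        using PInf c' by (intro that[of "ereal (c' - H' + 1)" "ereal (H' - 1)"]) auto
    next
      case PInf
      then show ?thesis
        using \<open>G = \<infinity>\<close> c' by (intro that[of "ereal c'" "ereal 0"]) auto
    qed (use assms in auto)
  qed (use assms in auto)
qed

lemma lsc_at_points_add:
  assumes "lsc_at_points T g" "lsc_at_points T h"
    and "\<And>x. x \<in> T \<Longrightarrow> g x \<noteq> -\<infinity>" "\<And>x. x \<in> T \<Longrightarrow> h x \<noteq> -\<infinity>"
  shows "lsc_at_points T (\<lambda>x. g x + h x)"
  unfolding lsc_at_points_def
proof (intro ballI allI impI)
  fix x c assume x: "x \<in> T" and c: "c < g x + h x"
  obtain a b where ab: "a < g x" "b < h x" "a \<noteq> -\<infinity>" "b \<noteq> -\<infinity>" "c \<le> a + b"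
    using ereal_less_add_split[OF c assms(3,4)[OF x]] by blast
  obtain U where U: "open U" "x \<in> U" "\<forall>y\<in>U \<inter> T. a < g y"
    using assms(1) x ab(1) unfolding lsc_at_points_def by blast
  obtain V where V: "open V" "x \<in> V" "\<forall>y\<in>V \<inter> T. b < h y"
    using assms(2) x ab(2) unfolding lsc_at_points_def by blast
  have "c < g y + h y" if y: "y \<in> (U \<inter> V) \<inter> T" for y
  proof -
    have "a + b < g y + h y"
      using U(3) V(3) y by (intro ereal_add_strict_mono2) auto
    then show ?thesis
      using ab(5) by simp
  qed
  then show "\<exists>U. open U \<and> x \<in> U \<and> (\<forall>y\<in>U \<inter> T. c < g y + h y)"
    using U V by (intro exI[of _ "U \<inter> V"]) auto
qed

lemma lsc_at_points_cmult:
  assumes "lsc_at_points T g" "0 < \<alpha>"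
  shows "lsc_at_points T (\<lambda>x. ereal \<alpha> * g x)"
  unfolding lsc_at_points_def
proof (intro ballI allI impI)
  fix x c assume x: "x \<in> T" and c: "c < ereal \<alpha> * g x"
  have *: "c < ereal \<alpha> * z \<longleftrightarrow> c / ereal \<alpha> < z" for z
    using assms(2) by (simp add: ereal_divide_less_iff mult.commute)
  then have "c / ereal \<alpha> < g x"
    using c by simp
  then show "\<exists>U. open U \<and> x \<in> U \<and> (\<forall>y\<in>U \<inter> T. c < ereal \<alpha> * g y)"
    using assms(1) x unfolding lsc_at_points_def * by blast
qed

lemma lsc_at_points_continuous:
  assumes "continuous_on UNIV (k :: 'a::topological_space \<Rightarrow> real)"
  shows "lsc_at_points T (\<lambda>x. ereal (k x))"
  unfolding lsc_at_points_def
proof (intro ballI allI impI)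
  fix x c assume x: "x \<in> T" and c: "c < ereal (k x)"
  have "open {y. c < ereal (k y)}"
    by (intro open_Collect_less continuous_intros continuous_on_ereal assms)
  then show "\<exists>U. open U \<and> x \<in> U \<and> (\<forall>y\<in>U \<inter> T. c < ereal (k y))"
    using c by (intro exI[of _ "{y. c < ereal (k y)}"]) auto
qed

text \<open>If no point were minimal, the sets on which \<open>h\<close> exceeds one of its values would form an open
  cover. The least of the values that belong to a finite subcover is then exceeded at its own
  point.\<close>

lemma lsc_attains_min_on_compact:
  assumes "compact T" "T \<noteq> {}" "lsc_at_points T h"
  obtains x where "x \<in> T" "\<And>y. y \<in> T \<Longrightarrow> h x \<le> h y"
proof (rule ccontr)
  assume "\<not> thesis"
  then have no_min: "\<exists>y\<in>T. h y < h x" if "x \<in> T" for x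
    using that \<open>\<And>x. \<lbrakk>x \<in> T; \<And>y. y \<in> T \<Longrightarrow> h x \<le> h y\<rbrakk> \<Longrightarrow> thesis\<close> by (meson not_le)
  let ?C = "{U. open U \<and> (\<exists>y\<in>T. \<forall>z\<in>U \<inter> T. h y < h z)}"
  have "T \<subseteq> \<Union>?C"
  proof
    fix x assume x: "x \<in> T"
    then obtain y where y: "y \<in> T" "h y < h x"
      using no_min by blast
    obtain U where "open U" "x \<in> U" "\<forall>z\<in>U \<inter> T. h y < h z"
      using assms(3) x y(2) unfolding lsc_at_points_def by blast
    then show "x \<in> \<Union>?C"
      using y(1) by blast
  qed
  then obtain D where D: "D \<subseteq> ?C" "finite D" "T \<subseteq> \<Union>D"
    using compactE[OF assms(1), of ?C] by blast
  have "\<forall>U\<in>D. \<exists>y. y \<in> T \<and> (\<forall>z\<in>U \<inter> T. h y < h z)"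
    using D(1) by blast
  from bchoice[OF this] obtain b where b: "\<forall>U\<in>D. b U \<in> T \<and> (\<forall>z\<in>U \<inter> T. h (b U) < h z)"
    by blast
  have "D \<noteq> {}"
    using D(3) assms(2) by auto
  then obtain U where U: "U \<in> D" "h (b U) = (MIN V\<in>D. h (b V))"
    using obtains_MIN[OF D(2), of "\<lambda>V. h (b V)"] by metis
  have "b U \<in> T"
    using U(1) b by blast
  then obtain V where V: "V \<in> D" "b U \<in> V"
    using D(3) by blast
  then have "h (b V) < h (b U)"
    using b \<open>b U \<in> T\<close> by blast
  then show False
    using U(2) D(2) V(1) by (simp add: leD)
qed

lemma lsc_bounded_below_on_compact:
  assumes "compact T" "lsc_at_points T h" "\<And>x. x \<in> T \<Longrightarrow> h x \<noteq> -\<infinity>"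
  obtains m where "\<And>x. x \<in> T \<Longrightarrow> ereal m \<le> h x"
proof (cases "T = {}")
  case False
  obtain x where x: "x \<in> T" "\<And>y. y \<in> T \<Longrightarrow> h x \<le> h y"
    using lsc_attains_min_on_compact[OF assms(1) False assms(2)] by blast
  show ?thesis
  proof (cases "h x")
    case (real m)
    then show ?thesis using x that by metis
  next
    case PInf
    then show ?thesis using x(2) that[of 0] by auto
  qed (use assms(3) x in auto)
qed (use that in auto)

lemma edom_real: "proper_on K h \<Longrightarrow> x \<in> edom K h \<Longrightarrow> h x = ereal (real_of_ereal (h x))"
  by (cases "h x") (auto simp: proper_on_def edom_def)

lemma edom_subset: "x \<in> edom K h \<Longrightarrow> x \<in> K"
  by (simp add: edom_def)

lemma edom_convex_combination:
  assumes "proper_on K h" "ereal_convex_on K h" "convex K"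
    and "x \<in> edom K h" "y \<in> edom K h" "0 \<le> t" "t \<le> 1"
  shows "(1 - t) *\<^sub>R x + t *\<^sub>R y \<in> edom K h"
    and "real_of_ereal (h ((1 - t) *\<^sub>R x + t *\<^sub>R y))
           \<le> (1 - t) * real_of_ereal (h x) + t * real_of_ereal (h y)"
proof -
  let ?z = "(1 - t) *\<^sub>R x + t *\<^sub>R y"
  have xy: "x \<in> K" "y \<in> K"
    using assms by (auto simp: edom_def)
  have z: "?z \<in> K"
    using convexD_alt[OF assms(3) xy] assms(6,7) by simp
  have "h ?z \<le> ereal (1 - t) * h x + ereal t * h y"
    using assms(2,6,7) xy unfolding ereal_convex_on_def by auto
  also have "\<dots> = ereal ((1 - t) * real_of_ereal (h x) + t * real_of_ereal (h y))"
    by (subst edom_real[OF assms(1,4)], subst edom_real[OF assms(1,5)]) simp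
  finally have le: "h ?z \<le> ereal ((1 - t) * real_of_ereal (h x) + t * real_of_ereal (h y))" .
  then show zin: "?z \<in> edom K h"
    using z by (auto simp: edom_def le_less_trans)
  show "real_of_ereal (h ?z) \<le> (1 - t) * real_of_ereal (h x) + t * real_of_ereal (h y)"
    using le by (subst (asm) edom_real[OF assms(1) zin]) simp
qed

lemma edom_convex_on:
  assumes "proper_on K h" "ereal_convex_on K h" "convex K"
  shows "convex_on (edom K h) (\<lambda>x. real_of_ereal (h x))"
proof (rule convex_onI)
  show "convex (edom K h)"
    unfolding convex_alt using edom_convex_combination(1)[OF assms] by blast
qed (use edom_convex_combination(2)[OF assms] in auto)

text \<open>On the unit ball around a point of the domain the function is bounded below by compactness;
  convexity along rays spreads this to a bound that decreases at most linearly.\<close>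

lemma convex_lsc_linear_lower_bound:
  fixes K :: "'a::euclidean_space set"
  assumes "closed K" "convex K" "proper_on K h" "ereal_convex_on K h" "lsc_on K h"
    and e: "e \<in> edom K h"
  obtains k where "0 \<le> k"
    "\<And>x. x \<in> edom K h \<Longrightarrow> real_of_ereal (h e) - k - k * norm (x - e) \<le> real_of_ereal (h x)"
proof -
  let ?T = "K \<inter> cball e 1" and ?h = "\<lambda>x. real_of_ereal (h x)"
  have "compact ?T"
    using assms(1) by (simp add: closed_Int_compact)
  moreover have "lsc_at_points ?T h"
    by (rule lsc_at_points_subset[OF lsc_on_imp_lsc_at_points[OF assms(5)]]) simp
  ultimately obtain m where m: "\<And>x. x \<in> ?T \<Longrightarrow> ereal m \<le> h x"
    using lsc_bounded_below_on_compact[of ?T h] assms(3) by (metis IntD1 proper_on_def)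
  have m': "m \<le> ?h x" if "x \<in> edom K h" "norm (x - e) \<le> 1" for x
    using m[of x] edom_real[OF assms(3) that(1)] that
    by (metis IntI dist_commute dist_norm edom_subset ereal_less_eq(3) mem_cball)
  define k where "k = ?h e - m"
  have k0: "0 \<le> k"
    using m'[OF e] by (simp add: k_def)
  show thesis
  proof (rule that[OF k0])
    fix x assume x: "x \<in> edom K h"
    let ?r = "norm (x - e)"
    show "?h e - k - k * ?r \<le> ?h x"
    proof (cases "?r \<le> 1")
      case True
      then have "?h e - k \<le> ?h x"
        using m'[OF x True] by (simp add: k_def)
      then show ?thesis
        using k0 by (smt (verit) mult_nonneg_nonneg norm_ge_zero)
    next
      case False
      define t where "t = 1 / ?r"
      have t: "0 \<le> t" "t \<le> 1" "0 < t"
        using False by (auto simp: t_def divide_le_eq_1)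
      let ?z = "(1 - t) *\<^sub>R e + t *\<^sub>R x"
      have "?z - e = t *\<^sub>R (x - e)"
        by (simp add: algebra_simps)
      then have "norm (?z - e) \<le> 1"
        using False by (simp add: t_def)
      then have "m \<le> (1 - t) * ?h e + t * ?h x"
        using m' edom_convex_combination[OF assms(3,4,2) e x t(1,2)] by fastforce
      then have "t * (?h e - ?h x) \<le> k"
        by (simp add: k_def algebra_simps)
      then have "?h e - ?h x \<le> k * ?r"
        using t(3) unfolding t_def by (simp add: pos_divide_le_eq)
      then show ?thesis
        using k0 by simp
    qed
  qed
qed


section \<open>Bregman distances\<close>

lemma convex_combination_eq: "(1 - t) *\<^sub>R x + t *\<^sub>R u = x + t *\<^sub>R (u - x)" for x u :: "'a::real_vector"
  by (simp add: algebra_simps)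

locale bregman_geometry =
  fixes K :: "'a::euclidean_space set" and N :: "'a \<Rightarrow> real" and f :: "'a \<Rightarrow> ereal"
    and gradf :: "'a \<Rightarrow> 'a"
  assumes N: "is_norm N"
    and K_closed: "closed K" and K_convex: "convex K"
    and f_proper: "proper_on K f" and f_convex: "ereal_convex_on K f" and f_lsc: "lsc_on K f"
    and f_gradient: "gradient_on K f gradf (dom_subdiff K f)"
    and f_strong: "strongly_convex1 N K f gradf"
begin

text \<open>On the domain of \<open>f\<close> all values are finite, and \<open>fr\<close> and \<open>D\<close> replace \<open>f\<close> and
  \<^const>\<open>bregman\<close> there.\<close>

definition fr :: "'a \<Rightarrow> real" where
  "fr x = real_of_ereal (f x)"

definition D :: "'a \<Rightarrow> 'a \<Rightarrow> real" where
  "D x y = fr x - fr y - gradf y \<bullet> (x - y)"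

lemma f_eq_fr: "x \<in> edom K f \<Longrightarrow> f x = ereal (fr x)"
  using edom_real[OF f_proper] by (simp add: fr_def)

lemma dom_subdiff_edom: "y \<in> dom_subdiff K f \<Longrightarrow> y \<in> edom K f"
  by (simp add: dom_subdiff_def)

lemma bregman_eq_D:
  "x \<in> edom K f \<Longrightarrow> y \<in> edom K f \<Longrightarrow> bregman f gradf x y = ereal (D x y)"
  by (simp add: bregman_def D_def f_eq_fr)

lemma D_ge_half_square:
  assumes "x \<in> edom K f" "y \<in> dom_subdiff K f"
  shows "(N (x - y))\<^sup>2 / 2 \<le> D x y"
proof -
  have "f y + ereal (gradf y \<bullet> (x - y)) + ereal ((N (x - y))\<^sup>2 / 2) \<le> f x"
    using f_strong assms unfolding strongly_convex1_def by blast
  then show ?thesis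
    using f_eq_fr[OF assms(1)] f_eq_fr[OF dom_subdiff_edom[OF assms(2)]] by (simp add: D_def)
qed

lemma D_nonneg: "x \<in> edom K f \<Longrightarrow> y \<in> dom_subdiff K f \<Longrightarrow> 0 \<le> D x y"
  using D_ge_half_square[of x y] zero_le_power2[of "N (x - y)"] by linarith

lemma gradient_strongly_monotone:
  assumes "x \<in> dom_subdiff K f" "y \<in> dom_subdiff K f"
  shows "(N (x - y))\<^sup>2 \<le> (gradf x - gradf y) \<bullet> (x - y)"
  using D_ge_half_square[OF dom_subdiff_edom[OF assms(1)] assms(2)]
    D_ge_half_square[OF dom_subdiff_edom[OF assms(2)] assms(1)] is_norm_minus_commute[OF N, of x y]
  by (simp add: D_def algebra_simps inner_diff_left inner_diff_right)

text \<open>Strong convexity of \<open>f\<close> outweighs the at most linear decrease of the other terms, so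
  that the minimum may be sought in a ball, where lower semicontinuity provides it.\<close>

lemma exists_minimizer:
  assumes g: "proper_on K g" "ereal_convex_on K g" "lsc_on K g" and e: "e \<in> edom K g \<inter> edom K f"
    and "0 < \<alpha>" and y: "y \<in> dom_subdiff K f"
  obtains x where "x \<in> edom K g \<inter> edom K f"
    "\<And>u. u \<in> edom K g \<inter> edom K f \<Longrightarrow>
       \<alpha> * real_of_ereal (g x) + l \<bullet> x + fr x \<le> \<alpha> * real_of_ereal (g u) + l \<bullet> u + fr u"
proof -
  define obj where "obj x = \<alpha> * real_of_ereal (g x) + l \<bullet> x + fr x" for x
  define h where "h x = ereal \<alpha> * g x + (ereal (l \<bullet> x) + f x)" for x
  have eg: "e \<in> edom K g" and ef: "e \<in> edom K f"
    using e by auto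
  have g_ninf: "g x \<noteq> -\<infinity>" and f_ninf: "f x \<noteq> -\<infinity>" if "x \<in> K" for x
    using g(1) f_proper that by (auto simp: proper_on_def)
  have h_obj: "h x = ereal (obj x)" if "x \<in> edom K g" "x \<in> edom K f" for x
    unfolding h_def obj_def using that by (subst edom_real[OF g(1)]) (auto simp: f_eq_fr)
  have h_fin: "x \<in> edom K g \<inter> edom K f" if "x \<in> K" "h x < \<infinity>" for x
    using that g_ninf[OF that(1)] f_ninf[OF that(1)] \<open>0 < \<alpha>\<close>
    unfolding h_def edom_def by (cases "g x"; cases "f x") auto
  have lsc: "lsc_at_points K h"
    unfolding h_def
  proof (intro lsc_at_points_add lsc_at_points_cmult lsc_at_points_continuous lsc_on_imp_lsc_at_points
      g(3) f_lsc \<open>0 < \<alpha>\<close> continuous_intros)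
    fix x assume "x \<in> K"
    then show "ereal \<alpha> * g x \<noteq> -\<infinity>" "f x \<noteq> -\<infinity>" "ereal (l \<bullet> x) \<noteq> -\<infinity>" "ereal (l \<bullet> x) + f x \<noteq> -\<infinity>"
      using g_ninf[of x] f_ninf[of x] \<open>0 < \<alpha>\<close> by (cases "g x"; cases "f x"; auto)+
  qed
  obtain k where k: "0 \<le> k"
    "\<And>x. x \<in> edom K g \<Longrightarrow> real_of_ereal (g e) - k - k * norm (x - e) \<le> real_of_ereal (g x)"
    using convex_lsc_linear_lower_bound[OF K_closed K_convex g eg] by blast
  obtain m where m: "0 < m" "\<And>x. m * norm x \<le> N x"
    using is_norm_dominates_norm[OF N] by blast
  define A where "A = \<alpha> * (real_of_ereal (g e) - k - k * norm (y - e)) + l \<bullet> y + fr y"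
  define B where "B = \<alpha> * k + norm l + norm (gradf y)"
  have B0: "0 \<le> B"
    using \<open>0 < \<alpha>\<close> k(1) by (simp add: B_def)
  have lower: "A - B * norm (x - y) + m\<^sup>2 / 2 * (norm (x - y))\<^sup>2 \<le> obj x"
    if x: "x \<in> edom K g" "x \<in> edom K f" for x
  proof -
    let ?s = "norm (x - y)"
    have "norm (x - e) \<le> ?s + norm (y - e)"
      using norm_triangle_ineq[of "x - y" "y - e"] by simp
    then have "k * norm (x - e) \<le> k * (?s + norm (y - e))"
      using k(1) by (rule mult_left_mono)
    then have "real_of_ereal (g e) - k - k * norm (y - e) - k * ?s \<le> real_of_ereal (g x)"
      using k(2)[OF x(1)] by (simp add: algebra_simps)
    then have 1: "\<alpha> * (real_of_ereal (g e) - k - k * norm (y - e) - k * ?s) \<le> \<alpha> * real_of_ereal (g x)"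
      using \<open>0 < \<alpha>\<close> by simp
    have 2: "l \<bullet> y - norm l * ?s \<le> l \<bullet> x"
      using Cauchy_Schwarz_ineq2[of l "x - y"] by (simp add: inner_diff_right abs_le_iff)
    have "m\<^sup>2 * ?s\<^sup>2 \<le> (N (x - y))\<^sup>2"
      using power_mono[OF m(2)[of "x - y"], of 2] m(1) by (simp add: power_mult_distrib)
    moreover have "- (norm (gradf y) * ?s) \<le> gradf y \<bullet> (x - y)"
      using Cauchy_Schwarz_ineq2[of "gradf y" "x - y"] by (simp add: abs_le_iff)
    ultimately have 3: "fr y - norm (gradf y) * ?s + m\<^sup>2 * ?s\<^sup>2 / 2 \<le> fr x"
      using D_ge_half_square[OF x(2) y] by (simp add: D_def)
    show ?thesis
      using 1 2 3 by (simp add: A_def B_def obj_def algebra_simps)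
  qed
  \<comment> \<open>Beyond this radius the quadratic term of \<open>lower\<close> dominates the linear one by enough to exceed
    \<open>obj e\<close>; the first entry keeps \<open>e\<close> in the ball.\<close>
  define R where "R = max (norm (e - y)) (max 1 (2 * (B + \<bar>obj e - A\<bar>) / m\<^sup>2))"
  have far: "obj e \<le> obj x" if x: "x \<in> edom K g" "x \<in> edom K f" and R: "R \<le> norm (x - y)" for x
  proof -
    let ?s = "norm (x - y)"
    have s1: "1 \<le> ?s" and "2 * (B + \<bar>obj e - A\<bar>) / m\<^sup>2 \<le> ?s"
      using R by (auto simp: R_def)
    then have "B + \<bar>obj e - A\<bar> \<le> m\<^sup>2 / 2 * ?s"
      using m(1) by (simp add: field_simps)
    then have "(B + \<bar>obj e - A\<bar>) * ?s \<le> m\<^sup>2 / 2 * ?s * ?s"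
      by (rule mult_right_mono) simp
    moreover have "\<bar>obj e - A\<bar> * 1 \<le> \<bar>obj e - A\<bar> * ?s"
      by (intro mult_left_mono s1) simp
    ultimately show ?thesis
      using lower[OF x] by (simp add: power2_eq_square algebra_simps abs_le_iff)
  qed
  let ?T = "K \<inter> cball y R"
  have eT: "e \<in> ?T"
    using edom_subset[OF eg] by (auto simp: R_def dist_norm norm_minus_commute)
  have "compact ?T" "lsc_at_points ?T h"
    using K_closed lsc_at_points_subset[OF lsc, of ?T] by (simp_all add: closed_Int_compact)
  then obtain x where x: "x \<in> ?T" "\<And>u. u \<in> ?T \<Longrightarrow> h x \<le> h u"
    using lsc_attains_min_on_compact[of ?T h] eT by blast
  have "h x < \<infinity>"
    using x(2)[OF eT] h_obj[OF eg ef] by auto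
  then have xin: "x \<in> edom K g \<inter> edom K f"
    using h_fin[of x] x(1) by blast
  show thesis
  proof (rule that[OF xin])
    fix u assume u: "u \<in> edom K g \<inter> edom K f"
    have "obj x \<le> obj u"
    proof (cases "norm (u - y) \<le> R")
      case True
      then have "u \<in> ?T"
        using u edom_subset[of u] by (auto simp: dist_norm norm_minus_commute)
      then show ?thesis
        using x(2)[of u] h_obj xin u by auto
    next
      case False
      then show ?thesis
        using far[of u] u x(2)[OF eT] h_obj[OF eg ef] h_obj[of x] xin by auto
    qed
    then show "\<alpha> * real_of_ereal (g x) + l \<bullet> x + fr x \<le> \<alpha> * real_of_ereal (g u) + l \<bullet> u + fr u"
      by (simp add: obj_def)
  qed
qed

text \<open>Comparing the minimizer with points on the segment towards \<open>u\<close> and letting them tend to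
  it; only a one-sided derivative of \<open>f\<close> within its domain enters.\<close>

lemma minimizer_variational_inequality:
  assumes G: "convex_on A G" and A: "A \<subseteq> edom K f"
    and x: "x \<in> A" "x \<in> dom_subdiff K f" and u: "u \<in> A"
    and min: "\<And>v. v \<in> A \<Longrightarrow> G x + l \<bullet> x + fr x \<le> G v + l \<bullet> v + fr v"
  shows "0 \<le> G u - G x + (l + gradf x) \<bullet> (u - x)"
proof -
  let ?p = "\<lambda>t::real. x + t *\<^sub>R (u - x)"
  have pA: "?p t \<in> A" if "t \<in> {0..1}" for t
    using convexD_alt[OF convex_on_imp_convex[OF G] x(1) u, of t] that convex_combination_eq[of t x u] by auto
  have "((\<lambda>v. real_of_ereal (f v)) has_derivative (\<lambda>h. gradf x \<bullet> h)) (at x within edom K f)"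
    using f_gradient x(2) unfolding gradient_on_def by blast
  then have "(fr has_derivative (\<lambda>h. gradf x \<bullet> h)) (at x within edom K f)"
    by (simp add: fr_def[abs_def])
  moreover have "?p ` {0..1} \<subseteq> edom K f"
  proof (rule image_subsetI)
    fix t :: real assume "t \<in> {0..1}"
    then show "?p t \<in> edom K f"
      using pA[of t] A by auto
  qed
  ultimately have "(fr has_derivative (\<lambda>h. gradf x \<bullet> h)) (at x within ?p ` {0..1})"
    by (rule has_derivative_subset)
  then have "(fr has_derivative (\<lambda>h. gradf x \<bullet> h)) (at (?p 0) within ?p ` {0..1})"
    by (simp only: scaleR_zero_left add_0_right)
  moreover have "(?p has_derivative (\<lambda>t. t *\<^sub>R (u - x))) (at 0 within {0..1})"
    by (auto intro!: derivative_eq_intros)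
  ultimately have "((\<lambda>t. fr (?p t)) has_derivative (\<lambda>t. gradf x \<bullet> (t *\<^sub>R (u - x)))) (at 0 within {0..1})"
    by (rule has_derivative_in_compose[rotated])
  moreover have "(\<lambda>t. gradf x \<bullet> (t *\<^sub>R (u - x))) = (*) (gradf x \<bullet> (u - x))"
    by (auto simp: mult.commute)
  ultimately have "((\<lambda>t. fr (?p t)) has_field_derivative gradf x \<bullet> (u - x)) (at 0 within {0..1})"
    by (simp add: has_field_derivative_def)
  then have lim: "((\<lambda>t. (fr (?p t) - fr x) / t) \<longlongrightarrow> gradf x \<bullet> (u - x)) (at 0 within {0..1})"
    by (simp add: has_field_derivative_iff)
  have "- (G u - G x + l \<bullet> (u - x)) \<le> (fr (?p t) - fr x) / t" if t: "t \<in> {0..1}" "t \<noteq> 0" for t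
  proof -
    have "G (?p t) \<le> (1 - t) * G x + t * G u"
      using convex_onD[OF G, of t x u] t(1) x(1) u convex_combination_eq[of t x u] by simp
    then have "0 \<le> t * (G u - G x + l \<bullet> (u - x)) + (fr (?p t) - fr x)"
      using min[OF pA[OF t(1)]] by (simp add: algebra_simps inner_add_right)
    moreover have "0 < t"
      using t by auto
    ultimately show ?thesis
      by (simp add: field_simps)
  qed
  then have "eventually (\<lambda>t. - (G u - G x + l \<bullet> (u - x)) \<le> (fr (?p t) - fr x) / t) (at 0 within {0..1})"
    by (auto simp: eventually_at_filter)
  moreover have "at (0::real) within {0..1} \<noteq> bot"
    by (simp add: at_within_Icc_at_right)
  ultimately have "- (G u - G x + l \<bullet> (u - x)) \<le> gradf x \<bullet> (u - x)"
    using tendsto_lowerbound[OF lim] by blast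
  then show ?thesis
    by (simp add: inner_add_left)
qed


section \<open>The conjugate of the Bregman distance\<close>

text \<open>The convex conjugate of \<open>D(\<cdot>, y)\<close>, with the linear functional normalized to vanish at \<open>y\<close>.\<close>

definition breg_conj :: "'a \<Rightarrow> 'a \<Rightarrow> real" where
  "breg_conj y z = (SUP u\<in>edom K f. z \<bullet> (u - y) - D u y)"

lemma breg_conj_term_le:
  assumes "y \<in> dom_subdiff K f" "u \<in> edom K f"
  shows "(r *\<^sub>R v) \<bullet> (u - y) - D u y \<le> r\<^sup>2 * (dual_norm N v)\<^sup>2 / 2"
  using inner_le_half_squares[OF N, of r v "u - y"] D_ge_half_square[OF assms(2,1)] by simp

lemma fenchel_young:
  assumes "y \<in> dom_subdiff K f" "u \<in> edom K f"
  shows "z \<bullet> (u - y) \<le> breg_conj y z + D u y"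
proof -
  have "z \<bullet> (u - y) - D u y \<le> breg_conj y z"
    unfolding breg_conj_def
  proof (rule cSUP_upper[OF assms(2) bdd_aboveI2])
    fix u assume "u \<in> edom K f"
    then show "z \<bullet> (u - y) - D u y \<le> 1\<^sup>2 * (dual_norm N z)\<^sup>2 / 2"
      using breg_conj_term_le[OF assms(1), of u 1 z] by simp
  qed
  then show ?thesis by simp
qed

lemma breg_conj_le:
  assumes "y \<in> dom_subdiff K f"
  shows "breg_conj y (r *\<^sub>R v) \<le> r\<^sup>2 * (dual_norm N v)\<^sup>2 / 2"
  unfolding breg_conj_def
  using breg_conj_term_le[OF assms] dom_subdiff_edom[OF assms] by (intro cSUP_least) auto

text \<open>The maximizer \<open>m\<close> has \<open>z + gradf y\<close> as a subgradient, which puts it into the domain of the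
  subdifferential; there strong convexity of \<open>f\<close> applies and yields quadratic decay away from \<open>m\<close>.\<close>

lemma breg_conj_maximizer:
  assumes y: "y \<in> dom_subdiff K f"
  obtains m where "m \<in> edom K f"
    "\<And>u. u \<in> edom K f \<Longrightarrow> z \<bullet> (u - y) - D u y \<le> z \<bullet> (m - y) - D m y - (N (u - m))\<^sup>2 / 2"
proof -
  let ?l = "- (z + gradf y)"
  have K0: "y \<in> K"
    using y by (simp add: dom_subdiff_def edom_def)
  have "proper_on K (\<lambda>_. 0)" "ereal_convex_on K (\<lambda>_. 0)" "lsc_on K (\<lambda>_. 0)"
    using K0 by (auto simp: proper_on_def ereal_convex_on_def lsc_on_def edom_def le_Liminf_iff)
  moreover have edom0: "edom K (\<lambda>_. 0) \<inter> edom K f = edom K f"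
    by (auto simp: edom_def)
  ultimately obtain m where m: "m \<in> edom K f"
    and le: "\<And>u. u \<in> edom K f \<Longrightarrow> ?l \<bullet> m + fr m \<le> ?l \<bullet> u + fr u"
    using exists_minimizer[of "\<lambda>_. 0" y 1 y ?l] y dom_subdiff_edom[OF y] by auto
  have "- ?l \<in> subdiff K f m"
    unfolding subdiff_def
  proof safe
    fix u assume u: "u \<in> K"
    show "f m + ereal ((- ?l) \<bullet> (u - m)) \<le> f u"
    proof (cases "u \<in> edom K f")
      case True
      then show ?thesis
        using le[OF True] m by (simp add: f_eq_fr inner_diff_right algebra_simps)
    qed (use u in \<open>auto simp: edom_def\<close>)
  qed
  then have msub: "m \<in> dom_subdiff K f"
    using m by (auto simp: dom_subdiff_def)
  show thesis
  proof (rule that[OF m])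
    fix u assume u: "u \<in> edom K f"
    have "0 \<le> (?l + gradf m) \<bullet> (u - m)"
      using minimizer_variational_inequality[of "edom K f" "\<lambda>_. 0" m u ?l]
        convex_on_const edom_convex_on[OF f_proper f_convex K_convex] convex_on_imp_convex m msub u le
      by (auto simp: convex_on_const)
    moreover have "(N (u - m))\<^sup>2 / 2 \<le> D u m"
      by (rule D_ge_half_square[OF u msub])
    ultimately show "z \<bullet> (u - y) - D u y \<le> z \<bullet> (m - y) - D m y - (N (u - m))\<^sup>2 / 2"
      by (simp add: D_def algebra_simps inner_diff_right inner_add_left inner_diff_left)
  qed
qed

end


section \<open>Expectations over finitely supported distributions\<close>

lemma expectation_bind_finite:
  fixes h :: "'b \<Rightarrow> real"
  assumes "finite (set_pmf P)" "\<And>x. x \<in> set_pmf P \<Longrightarrow> finite (set_pmf (k x))"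
  shows "measure_pmf.expectation (bind_pmf P k) h
           = measure_pmf.expectation P (\<lambda>x. measure_pmf.expectation (k x) h)"
  using assms by (subst pmf_expectation_bind[of "set_pmf P"]) (auto simp: integral_measure_pmf[of "set_pmf P"])

lemma expectation_mono_finite:
  fixes h k :: "'b \<Rightarrow> real"
  assumes "finite (set_pmf P)" "\<And>x. x \<in> set_pmf P \<Longrightarrow> h x \<le> k x"
  shows "measure_pmf.expectation P h \<le> measure_pmf.expectation P k"
  using assms by (intro integral_mono_AE) (auto simp: AE_measure_pmf_iff integrable_measure_pmf_finite)

lemma expectation_add_finite:
  fixes h k :: "'b \<Rightarrow> 'c::{banach, second_countable_topology}"
  assumes "finite (set_pmf P)"
  shows "measure_pmf.expectation P (\<lambda>x. h x + k x) = measure_pmf.expectation P h + measure_pmf.expectation P k"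
  using assms by (intro Bochner_Integration.integral_add integrable_measure_pmf_finite)

lemma expectation_diff_finite:
  fixes h k :: "'b \<Rightarrow> 'c::{banach, second_countable_topology}"
  assumes "finite (set_pmf P)"
  shows "measure_pmf.expectation P (\<lambda>x. h x - k x) = measure_pmf.expectation P h - measure_pmf.expectation P k"
  using assms by (intro Bochner_Integration.integral_diff integrable_measure_pmf_finite)

lemma finite_set_replicate_pmf:
  assumes "finite (set_pmf P)"
  shows "finite (set_pmf (replicate_pmf n P))"
  using finite_lists_length_eq[OF assms, of n]
  by (simp add: set_replicate_pmf lists_eq_set Collect_conj_eq[symmetric] conj_commute)

lemma expectation_sum_list_replicate:
  fixes h :: "'b \<Rightarrow> real"
  assumes "finite (set_pmf P)"
  shows "measure_pmf.expectation (replicate_pmf n P) (\<lambda>B. \<Sum>\<xi>\<leftarrow>B. h \<xi>)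
           = real n * measure_pmf.expectation P h"
proof (induction n)
  case (Suc n)
  have fin: "finite (set_pmf (replicate_pmf n P))"
    by (rule finite_set_replicate_pmf[OF assms])
  have "measure_pmf.expectation (replicate_pmf (Suc n) P) (\<lambda>B. \<Sum>\<xi>\<leftarrow>B. h \<xi>)
      = measure_pmf.expectation P (\<lambda>\<xi>. measure_pmf.expectation (replicate_pmf n P) (\<lambda>B. h \<xi> + (\<Sum>\<xi>\<leftarrow>B. h \<xi>)))"
    using fin assms by (simp add: expectation_bind_finite)
  also have "\<dots> = measure_pmf.expectation P (\<lambda>\<xi>. h \<xi> + real n * measure_pmf.expectation P h)"
    using fin by (simp add: expectation_add_finite Suc.IH)
  also have "\<dots> = real (Suc n) * measure_pmf.expectation P h"
    using assms by (simp add: expectation_add_finite algebra_simps)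
  finally show ?case .
qed simp

lemma sum_list_inner: "(\<Sum>\<xi>\<leftarrow>B. h \<xi>) \<bullet> v = (\<Sum>\<xi>\<leftarrow>B. h \<xi> \<bullet> v)"
  by (induction B) (simp_all add: inner_add_left)

context bregman_geometry
begin

text \<open>The conjugate is smooth with respect to the dual norm: quadratic decay at the maximizer \<open>m\<close> for
  \<open>z\<close> bounds \<open>breg_conj y (z + r *\<^sub>R A)\<close> by an affine function of \<open>A\<close> plus a square. Averaging
  replaces \<open>A\<close> by its mean \<open>a\<close> in the affine function, and that value is one of the candidates in
  the supremum that defines \<open>breg_conj y (z + r *\<^sub>R a)\<close>. Expanding at \<open>z\<close> rather than at
  \<open>z + r *\<^sub>R a\<close> makes the raw second moment of \<open>A\<close> appear; outside Euclidean norms that of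
  \<open>A - a\<close> may be larger.\<close>

lemma breg_conj_mean_step:
  assumes P: "finite (set_pmf P)" and y: "y \<in> dom_subdiff K f"
    and a: "a = measure_pmf.expectation P A"
  shows "measure_pmf.expectation P (\<lambda>\<xi>. breg_conj y (z + r *\<^sub>R A \<xi>))
           \<le> breg_conj y (z + r *\<^sub>R a) + r\<^sup>2 / 2 * measure_pmf.expectation P (\<lambda>\<xi>. (dual_norm N (A \<xi>))\<^sup>2)"
proof -
  obtain m where m: "m \<in> edom K f"
    and max: "\<And>u. u \<in> edom K f \<Longrightarrow> z \<bullet> (u - y) - D u y \<le> z \<bullet> (m - y) - D m y - (N (u - m))\<^sup>2 / 2"
    using breg_conj_maximizer[OF y, of z] by blast
  let ?c = "z \<bullet> (m - y) - D m y"
  have step: "breg_conj y (z + r *\<^sub>R A \<xi>) \<le> ?c + (r * (A \<xi> \<bullet> (m - y)) + r\<^sup>2 / 2 * (dual_norm N (A \<xi>))\<^sup>2)" for \<xi>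
    unfolding breg_conj_def
  proof (rule cSUP_least)
    fix u assume u: "u \<in> edom K f"
    show "(z + r *\<^sub>R A \<xi>) \<bullet> (u - y) - D u y \<le> ?c + (r * (A \<xi> \<bullet> (m - y)) + r\<^sup>2 / 2 * (dual_norm N (A \<xi>))\<^sup>2)"
      using max[OF u] inner_le_half_squares[OF N, of r "A \<xi>" "u - m"]
      by (simp add: inner_add_left algebra_simps inner_diff_right)
  qed (use m in auto)
  have "measure_pmf.expectation P (\<lambda>\<xi>. breg_conj y (z + r *\<^sub>R A \<xi>))
      \<le> measure_pmf.expectation P (\<lambda>\<xi>. ?c + (r * (A \<xi> \<bullet> (m - y)) + r\<^sup>2 / 2 * (dual_norm N (A \<xi>))\<^sup>2))"
    by (rule expectation_mono_finite[OF P step])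
  also have "\<dots> = ?c + (r * measure_pmf.expectation P (\<lambda>\<xi>. A \<xi> \<bullet> (m - y))
      + r\<^sup>2 / 2 * measure_pmf.expectation P (\<lambda>\<xi>. (dual_norm N (A \<xi>))\<^sup>2))"
    using P by (simp add: expectation_add_finite)
  also have "measure_pmf.expectation P (\<lambda>\<xi>. A \<xi> \<bullet> (m - y)) = a \<bullet> (m - y)"
    unfolding a by (rule integral_inner_left) (simp add: integrable_measure_pmf_finite[OF P])
  also have "?c + (r * (a \<bullet> (m - y)) + r\<^sup>2 / 2 * measure_pmf.expectation P (\<lambda>\<xi>. (dual_norm N (A \<xi>))\<^sup>2))
      \<le> breg_conj y (z + r *\<^sub>R a) + r\<^sup>2 / 2 * measure_pmf.expectation P (\<lambda>\<xi>. (dual_norm N (A \<xi>))\<^sup>2)"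
    using fenchel_young[OF y m, of "z + r *\<^sub>R a"] by (simp add: inner_add_left)
  finally show ?thesis .
qed

text \<open>The samples enter one at a time, so that their second moments add up. With \<open>r = 1 / n\<close> this
  is the reduction of the variance by the batch size.\<close>

lemma breg_conj_mean_batch:
  assumes P: "finite (set_pmf P)" and y: "y \<in> dom_subdiff K f"
    and a: "a = measure_pmf.expectation P A"
  shows "measure_pmf.expectation (replicate_pmf n P) (\<lambda>B. breg_conj y (z + r *\<^sub>R (\<Sum>\<xi>\<leftarrow>B. A \<xi>)))
           \<le> breg_conj y (z + (r * real n) *\<^sub>R a)
             + real n * (r\<^sup>2 / 2 * measure_pmf.expectation P (\<lambda>\<xi>. (dual_norm N (A \<xi>))\<^sup>2))"
proof (induction n arbitrary: z)
  case (Suc n)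
  let ?v = "r\<^sup>2 / 2 * measure_pmf.expectation P (\<lambda>\<xi>. (dual_norm N (A \<xi>))\<^sup>2)"
  have fin: "finite (set_pmf (replicate_pmf n P))"
    by (rule finite_set_replicate_pmf[OF P])
  have "measure_pmf.expectation (replicate_pmf (Suc n) P) (\<lambda>B. breg_conj y (z + r *\<^sub>R (\<Sum>\<xi>\<leftarrow>B. A \<xi>)))
      = measure_pmf.expectation P (\<lambda>\<xi>. measure_pmf.expectation (replicate_pmf n P)
          (\<lambda>B. breg_conj y ((z + r *\<^sub>R A \<xi>) + r *\<^sub>R (\<Sum>\<xi>\<leftarrow>B. A \<xi>))))"
    using fin P by (simp add: expectation_bind_finite algebra_simps)
  also have "\<dots> \<le> measure_pmf.expectation P
      (\<lambda>\<xi>. breg_conj y ((z + r *\<^sub>R A \<xi>) + (r * real n) *\<^sub>R a) + real n * ?v)"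
    by (rule expectation_mono_finite[OF P Suc.IH])
  also have "\<dots> = measure_pmf.expectation P (\<lambda>\<xi>. breg_conj y ((z + (r * real n) *\<^sub>R a) + r *\<^sub>R A \<xi>)) + real n * ?v"
    using P by (simp add: expectation_add_finite add_ac)
  also have "\<dots> \<le> breg_conj y ((z + (r * real n) *\<^sub>R a) + r *\<^sub>R a) + ?v + real n * ?v"
    using breg_conj_mean_step[OF P y a, of "z + (r * real n) *\<^sub>R a" r] by simp
  also have "(z + (r * real n) *\<^sub>R a) + r *\<^sub>R a = z + (r * real (Suc n)) *\<^sub>R a"
    by (simp add: algebra_simps)
  finally show ?case
    by (simp add: algebra_simps add_divide_distrib)
qed simp

end


section \<open>Averaging over the coin\<close>

text \<open>The numbers stand for distances to two points \<open>x\<close> and \<open>x'\<close> that are \<open>v\<close> apart: \<open>P\<close> and \<open>W\<close> are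
  those of a point \<open>X\<close> to \<open>x\<close> and to \<open>x'\<close>, and \<open>U\<close> and \<open>R\<close> those of a point \<open>Y\<close> with
  \<open>\<parallel>X - Y\<parallel> \<le> c v\<close>. For \<open>X = Y\<close> the left-hand side vanishes. Equality holds on a line, with \<open>x'\<close>,
  \<open>X\<close>, \<open>Y\<close>, \<open>x\<close> in this order and \<open>X\<close>, \<open>Y\<close> placed symmetrically at distance \<open>c v\<close>.\<close>

lemma square_defect_le:
  fixes P U R W v c :: real
  assumes nonneg: "0 \<le> P" "0 \<le> U" "0 \<le> R" "0 \<le> W" "0 \<le> v" "0 \<le> c" "c \<le> 1"
    and close: "P \<le> U + c * v" "R \<le> W + c * v"
    and tri: "v \<le> P + W" "v \<le> R + U" "P \<le> v + W" "R \<le> v + U"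
  shows "(1 + c)\<^sup>2 * (P\<^sup>2 - U\<^sup>2 + R\<^sup>2 - W\<^sup>2) \<le> 2 * c * (P + R)\<^sup>2"
proof -
  \<comment> \<open>By the symmetry that exchanges \<open>P\<close> with \<open>R\<close> and \<open>U\<close> with \<open>W\<close>, the larger of the differences
    \<open>P - U\<close> and \<open>R - W\<close> may be assumed to be the first.\<close>
  have key: "(1 + c)\<^sup>2 * (P\<^sup>2 - U\<^sup>2 + R\<^sup>2 - W\<^sup>2) \<le> 2 * c * (P + R)\<^sup>2"
    if nonneg: "0 \<le> P" "0 \<le> R" "0 \<le> v" and close: "P \<le> U + c * v"
      and tri: "v \<le> R + U" "P \<le> v + W" and kl: "R - W \<le> P - U" for P U R W :: real
  proof -
    define k l n where "k = P - U" and "l = R - W" and "n = R + U"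
    have n: "0 \<le> n" "v \<le> n"
      using tri nonneg by (auto simp: n_def)
    have "(k - l) * (P - R) \<le> (k - l) * (v - l)"
      using tri kl by (intro mult_left_mono) (auto simp: k_def l_def)
    moreover have "(k - l) * (v - n) \<le> 0"
      using kl n by (intro mult_nonneg_nonpos) (auto simp: k_def l_def)
    ultimately have le: "P\<^sup>2 - U\<^sup>2 + R\<^sup>2 - W\<^sup>2 \<le> 2 * (k * n)"
      by (simp add: k_def l_def n_def power2_eq_square algebra_simps)
    have "k \<le> c * n"
      using close n mult_left_mono[OF n(2) \<open>0 \<le> c\<close>] by (simp add: k_def)
    moreover from this have "c * k \<le> n"
      using mult_left_mono[of k "c * n" c] mult_left_le[of "c * c" n] mult_le_one[of c c] \<open>0 \<le> c\<close> \<open>c \<le> 1\<close> n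
      by (simp add: algebra_simps)
    ultimately have "0 \<le> (c * n - k) * (n - c * k)"
      by simp
    then have "(1 + c)\<^sup>2 * (k * n) \<le> c * (n + k)\<^sup>2"
      by (simp add: power2_eq_square algebra_simps)
    moreover have "n + k = P + R"
      by (simp add: n_def k_def)
    ultimately show ?thesis
      using mult_left_mono[OF le, of "(1 + c)\<^sup>2"] by simp
  qed
  show ?thesis
  proof (cases "R - W \<le> P - U")
    case True
    then show ?thesis using key[of P R U W] assms by simp
  next
    case False
    then show ?thesis using key[of R P W U] assms by (simp add: algebra_simps)
  qed
qed

lemma square_sum_le_weighted:
  fixes p P R :: real
  shows "p * (1 - p) * (P + R)\<^sup>2 \<le> p * P\<^sup>2 + (1 - p) * R\<^sup>2"
proof -
  have "p * P\<^sup>2 + (1 - p) * R\<^sup>2 - p * (1 - p) * (P + R)\<^sup>2 = (p * P - (1 - p) * R)\<^sup>2"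
    by (simp add: power2_eq_square algebra_simps)
  then show ?thesis
    by (metis diff_ge_0_iff_ge zero_le_power2)
qed

lemma contraction_slack:
  fixes c :: real
  assumes "0 \<le> c"
  shows "2 * c \<le> (1 / 4 + 2 * c\<^sup>2) * (1 + c)\<^sup>2"
proof -
  have "(1 / 4 + 2 * c\<^sup>2) * (1 + c)\<^sup>2 - 2 * c = (1 - 3 * c)\<^sup>2 / 4 + 4 * c ^ 3 + 2 * c ^ 4"
    by (simp add: power2_eq_square power3_eq_cube power4_eq_xxxx field_simps)
  also have "0 \<le> \<dots>"
    using assms by simp
  finally show ?thesis by simp
qed

text \<open>With \<open>P = U\<close> and \<open>W = R\<close> the expression is \<open>1 - \<kappa>\<close> times a weighted mean of \<open>P\<^sup>2\<close> and \<open>R\<^sup>2\<close>. The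
  error made by moving one point to the other is the defect of \<open>square_defect_le\<close>, weighted by
  \<open>p (1 - p)\<close>; this weight turns \<open>(P + R)\<^sup>2\<close> into the same weighted mean, independently of \<open>p\<close>.\<close>

lemma coin_average_nonneg:
  fixes P U R W v c p :: real
  assumes nonneg: "0 \<le> P" "0 \<le> U" "0 \<le> R" "0 \<le> W" "0 \<le> v" "0 \<le> c" "c \<le> 1"
    and close: "P \<le> U + c * v" "R \<le> W + c * v"
    and tri: "v \<le> P + W" "v \<le> R + U" "P \<le> v + W" "R \<le> v + U"
    and p: "0 \<le> p" "p \<le> 1" and \<kappa>: "\<kappa> \<le> 3 / 4 - 2 * c\<^sup>2"
  shows "0 \<le> p * (p * P\<^sup>2 + (1 - p) * W\<^sup>2 - \<kappa> * P\<^sup>2) + (1 - p) * (p * U\<^sup>2 + (1 - p) * R\<^sup>2 - \<kappa> * R\<^sup>2)"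
proof -
  define \<rho> where "\<rho> = 1 / 4 + 2 * c\<^sup>2"
  have \<rho>: "0 \<le> \<rho>"
    by (simp add: \<rho>_def)
  let ?def = "P\<^sup>2 - U\<^sup>2 + R\<^sup>2 - W\<^sup>2" and ?w = "p * P\<^sup>2 + (1 - p) * R\<^sup>2"
  have "(1 + c)\<^sup>2 * ?def \<le> 2 * c * (P + R)\<^sup>2"
    by (rule square_defect_le[OF assms(1-13)])
  also have "\<dots> \<le> (\<rho> * (1 + c)\<^sup>2) * (P + R)\<^sup>2"
    using contraction_slack[OF \<open>0 \<le> c\<close>] by (intro mult_right_mono) (auto simp: \<rho>_def)
  finally have "(1 + c)\<^sup>2 * ?def \<le> (1 + c)\<^sup>2 * (\<rho> * (P + R)\<^sup>2)"
    by (simp add: algebra_simps)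
  then have "?def \<le> \<rho> * (P + R)\<^sup>2"
    using \<open>0 \<le> c\<close> by (simp add: mult_le_cancel_left_pos)
  then have "p * (1 - p) * ?def \<le> p * (1 - p) * (\<rho> * (P + R)\<^sup>2)"
    using p by (intro mult_left_mono) auto
  also have "\<dots> = \<rho> * (p * (1 - p) * (P + R)\<^sup>2)"
    by simp
  also have "\<dots> \<le> \<rho> * ?w"
    by (intro mult_left_mono square_sum_le_weighted \<rho>)
  also have "\<dots> \<le> (1 - \<kappa>) * ?w"
    using \<kappa> p by (intro mult_right_mono) (auto simp: \<rho>_def)
  finally show ?thesis
    by (simp add: algebra_simps)
qed


section \<open>One step of the method\<close>

locale reflected_method = bregman_geometry +
  fixes g :: "'a \<Rightarrow> ereal" and F :: "'a \<Rightarrow> 'a" and Fxi :: "nat \<Rightarrow> 'a \<Rightarrow> 'a"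
    and Q :: "'a \<Rightarrow> 'a \<Rightarrow> nat pmf" and \<gamma> p \<alpha> L Lbar :: real and M b :: nat and x0 :: 'a
  assumes g_proper: "proper_on K g" and g_convex: "ereal_convex_on K g" and g_lsc: "lsc_on K g"
    and dom_g: "edom K g \<subseteq> edom K f"
    and F_monotone: "monotone_operator_on (edom K g) F"
    and F_oracle: "variable_lipschitz_oracle N Lbar (edom K g) M F Fxi Q"
    and L_nonneg: "0 \<le> L" and F_lipschitz: "operator_lipschitz_on N L (edom K g) F"
    and p: "0 < p" "p < 1" and \<gamma>: "p < \<gamma>" "\<gamma> < 1" and \<alpha>_pos: "0 < \<alpha>" and b: "1 \<le> b"
    and \<alpha>_le: "\<alpha> \<le> min ((\<gamma> - p) / (2 * (1 - p)))
                  ((1 - \<gamma>) * real b / ((1 - p) * (2 * Lbar\<^sup>2 + real b * L\<^sup>2)))"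
    and x0: "x0 \<in> edom K g"
begin

definition gr :: "'a \<Rightarrow> real" where
  "gr x = real_of_ereal (g x)"

text \<open>The weight \<open>\<theta>\<close> is determined by \<open>\<gamma> - \<theta> : 1 - \<gamma> = p : 1 - p\<close>: once \<open>\<theta> D(X, x)\<close> is spent on the
  cross term, the remaining weights of \<open>D(X, x)\<close> and \<open>D(X, x')\<close> are in the ratio of the
  probabilities with which \<open>w\<close> is \<open>x\<close> or \<open>x'\<close>.\<close>

definition \<theta> :: real where
  "\<theta> = (\<gamma> - p) / (1 - p)"

text \<open>The total charge on \<open>\<parallel>x - w'\<parallel>\<^sup>2 / 2\<close> in one step. The first summand comes from the accumulated
  noise and the second from the cross term.\<close>

definition \<kappa> :: real where
  "\<kappa> = \<alpha> * (Lbar\<^sup>2 / real b) + \<alpha>\<^sup>2 / \<theta> * (L\<^sup>2 + Lbar\<^sup>2 / real b)"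

lemma g_eq_gr: "x \<in> edom K g \<Longrightarrow> g x = ereal (gr x)"
  using edom_real[OF g_proper] by (simp add: gr_def)

lemma \<theta>: "0 < \<theta>" "\<theta> < 1" "\<gamma> - \<theta> = p * (1 - \<theta>)" "1 - \<gamma> = (1 - p) * (1 - \<theta>)" "\<alpha> \<le> \<theta> / 2"
  using p \<gamma> \<alpha>_le by (auto simp: \<theta>_def field_simps)

lemma stepsize_bound: "\<alpha> * (2 * (Lbar\<^sup>2 / real b) + L\<^sup>2) \<le> 1 - \<theta>"
proof -
  let ?d = "(1 - p) * (2 * Lbar\<^sup>2 + real b * L\<^sup>2)"
  have le: "\<alpha> \<le> (1 - \<gamma>) * real b / ?d"
    using \<alpha>_le by simp
  have "0 \<le> ?d"
    using p by simp
  moreover have "?d \<noteq> 0"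
    using le \<alpha>_pos by auto
  ultimately have "0 < ?d"
    by linarith
  then have "\<alpha> * ?d \<le> (1 - p) * (1 - \<theta>) * real b"
    using le unfolding \<theta>(4)[symmetric] by (subst (asm) pos_le_divide_eq) auto
  then have "(1 - p) * (\<alpha> * (2 * Lbar\<^sup>2 + real b * L\<^sup>2)) \<le> (1 - p) * ((1 - \<theta>) * real b)"
    by (simp add: mult_ac)
  then have "\<alpha> * (2 * Lbar\<^sup>2 + real b * L\<^sup>2) \<le> (1 - \<theta>) * real b"
    using p by (simp add: mult_le_cancel_left_pos)
  moreover have "\<alpha> * (2 * (Lbar\<^sup>2 / real b) + L\<^sup>2) = \<alpha> * (2 * Lbar\<^sup>2 + real b * L\<^sup>2) / real b"
    using b by (simp add: field_simps)
  ultimately show ?thesis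
    using b by (simp add: pos_divide_le_eq)
qed

lemma \<kappa>_nonneg: "0 \<le> \<kappa>"
  using \<theta>(1) \<alpha>_pos by (simp add: \<kappa>_def)

lemma \<kappa>_ge: "(\<alpha> * L)\<^sup>2 \<le> \<kappa>"
proof -
  have "\<alpha>\<^sup>2 * L\<^sup>2 * \<theta> \<le> \<alpha>\<^sup>2 * L\<^sup>2 * 1"
    using \<theta> by (intro mult_left_mono) auto
  also have "\<dots> \<le> \<alpha>\<^sup>2 * (L\<^sup>2 + Lbar\<^sup>2 / real b)"
    by (simp add: algebra_simps)
  finally have "\<alpha>\<^sup>2 * L\<^sup>2 \<le> \<alpha>\<^sup>2 / \<theta> * (L\<^sup>2 + Lbar\<^sup>2 / real b)"
    using \<theta>(1) by (simp add: pos_le_divide_eq)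
  moreover have "0 \<le> \<alpha> * (Lbar\<^sup>2 / real b)"
    using \<alpha>_pos by simp
  ultimately show ?thesis
    by (simp add: \<kappa>_def power_mult_distrib)
qed

text \<open>Since \<open>\<alpha> \<le> \<theta> / 2\<close>, \<open>\<kappa>\<close> is at most three quarters of the left-hand side of \<open>stepsize_bound\<close>
  minus \<open>\<alpha> L\<^sup>2 / 4\<close>; this remainder provides the term with \<open>(\<alpha> L)\<^sup>2\<close> because
  \<open>8 \<alpha> (1 - \<theta>) \<le> 4 \<theta> (1 - \<theta>) \<le> 1\<close>.\<close>

lemma \<kappa>_le: "\<kappa> \<le> (1 - \<theta>) * (3 / 4 - 2 * (\<alpha> * L)\<^sup>2)"
proof -
  let ?s = "Lbar\<^sup>2 / real b"
  have "\<alpha>\<^sup>2 / \<theta> = \<alpha> * (\<alpha> / \<theta>)"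
    by (simp add: power2_eq_square)
  also have "\<dots> \<le> \<alpha> * (1 / 2)"
    using \<theta>(1,5) \<alpha>_pos by (intro mult_left_mono) (auto simp: field_simps)
  finally have "\<alpha>\<^sup>2 / \<theta> * (L\<^sup>2 + ?s) \<le> \<alpha> * (1 / 2) * (L\<^sup>2 + ?s)"
    by (rule mult_right_mono) simp
  then have "\<kappa> \<le> \<alpha> * ?s + \<alpha> * (1 / 2) * (L\<^sup>2 + ?s)"
    by (simp add: \<kappa>_def)
  also have "\<dots> = 3 / 4 * (\<alpha> * (2 * ?s + L\<^sup>2)) - \<alpha> * L\<^sup>2 / 4"
    by (simp add: algebra_simps)
  also have "\<dots> \<le> 3 / 4 * (1 - \<theta>) - \<alpha> * L\<^sup>2 / 4"
    using stepsize_bound by simp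
  also have "\<dots> \<le> 3 / 4 * (1 - \<theta>) - (1 - \<theta>) * (2 * (\<alpha> * L)\<^sup>2)"
  proof -
    have "0 \<le> (1 - 2 * \<theta>)\<^sup>2"
      by simp
    then have "4 * (\<theta> * (1 - \<theta>)) \<le> 1"
      by (simp add: power2_eq_square algebra_simps)
    moreover have "8 * (\<alpha> * (1 - \<theta>)) \<le> 8 * (\<theta> / 2 * (1 - \<theta>))"
      using \<theta> by (intro mult_left_mono mult_right_mono) auto
    ultimately have "8 * (\<alpha> * (1 - \<theta>)) \<le> 1"
      by simp
    then have "8 * (\<alpha> * (1 - \<theta>)) * (\<alpha> * L\<^sup>2) \<le> 1 * (\<alpha> * L\<^sup>2)"
      using \<alpha>_pos by (intro mult_right_mono) auto
    then show ?thesis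
      by (simp add: power2_eq_square algebra_simps)
  qed
  finally show ?thesis
    by (simp add: algebra_simps)
qed

lemma \<alpha>L: "0 \<le> \<alpha> * L" "\<alpha> * L \<le> 1"
proof -
  have "0 \<le> (1 - \<theta>) * (3 / 4 - 2 * (\<alpha> * L)\<^sup>2)"
    using \<kappa>_le \<kappa>_nonneg by simp
  then have "0 \<le> 3 / 4 - 2 * (\<alpha> * L)\<^sup>2"
    using \<theta>(2) by (simp add: zero_le_mult_iff)
  then have "(\<alpha> * L)\<^sup>2 \<le> 1\<^sup>2"
    by simp
  then show "\<alpha> * L \<le> 1"
    by (rule power2_le_imp_le) simp
qed (use \<alpha>_pos L_nonneg in simp)

lemma F_lipschitzD: "x \<in> edom K g \<Longrightarrow> y \<in> edom K g \<Longrightarrow> dual_norm N (F x - F y) \<le> L * N (x - y)"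
  using F_lipschitz by (simp add: operator_lipschitz_on_def)

lemma oracleD:
  assumes "x \<in> edom K g" "y \<in> edom K g"
  shows "finite (set_pmf (Q x y))"
    and "F x - F y = measure_pmf.expectation (Q x y) (\<lambda>\<xi>. Fxi \<xi> x - Fxi \<xi> y)"
    and "measure_pmf.expectation (Q x y) (\<lambda>\<xi>. (dual_norm N (Fxi \<xi> x - Fxi \<xi> y))\<^sup>2) \<le> Lbar\<^sup>2 * (N (x - y))\<^sup>2"
proof -
  have Q: "set_pmf (Q x y) \<subseteq> {1..M}"
    and mean: "\<And>z. z \<in> edom K g \<Longrightarrow> F z = measure_pmf.expectation (Q x y) (\<lambda>\<xi>. Fxi \<xi> z)"
    and var: "measure_pmf.expectation (Q x y) (\<lambda>\<xi>. (dual_norm N (Fxi \<xi> x - Fxi \<xi> y))\<^sup>2) \<le> Lbar\<^sup>2 * (N (x - y))\<^sup>2"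
    using F_oracle assms unfolding variable_lipschitz_oracle_def by blast+
  show fin: "finite (set_pmf (Q x y))"
    using Q finite_subset by blast
  show "F x - F y = measure_pmf.expectation (Q x y) (\<lambda>\<xi>. Fxi \<xi> x - Fxi \<xi> y)"
    using mean[OF assms(1)] mean[OF assms(2)] by (simp add: expectation_diff_finite[OF fin])
  show "measure_pmf.expectation (Q x y) (\<lambda>\<xi>. (dual_norm N (Fxi \<xi> x - Fxi \<xi> y))\<^sup>2) \<le> Lbar\<^sup>2 * (N (x - y))\<^sup>2"
    by (rule var)
qed

definition batch_diff :: "nat list \<Rightarrow> 'a \<Rightarrow> 'a \<Rightarrow> 'a" where
  "batch_diff B x w' = (1 / real b) *\<^sub>R (\<Sum>\<xi>\<leftarrow>B. Fxi \<xi> x - Fxi \<xi> w')"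

definition new_point :: "nat list \<Rightarrow> 'a \<Rightarrow> 'a \<Rightarrow> 'a \<Rightarrow> 'a \<Rightarrow> 'a" where
  "new_point B x x' w w' =
     prox_step K f gradf g \<alpha> (batch_direction F Fxi b B x w w') (mirror_mean K f gradf \<gamma> x x')"

lemma batch_direction_eq:
  assumes "length B = b"
  shows "batch_direction F Fxi b B x w w' = F w + batch_diff B x w'"
proof -
  have "(\<Sum>\<xi>\<leftarrow>B. F w + Fxi \<xi> x - Fxi \<xi> w') = real (length B) *\<^sub>R F w + (\<Sum>\<xi>\<leftarrow>B. Fxi \<xi> x - Fxi \<xi> w')"
    by (induction B) (simp_all add: algebra_simps)
  then show ?thesis
    using assms b by (simp add: batch_direction_def batch_diff_def scaleR_add_right)
qed

text \<open>The proximal step is a choice among minimizers over all of \<open>K\<close>, so their existence has to be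
  known before anything can be said about it.\<close>

lemma prox_step_minimizes:
  fixes \<Delta> :: 'a
  assumes y: "y \<in> dom_subdiff K f"
  defines "X \<equiv> prox_step K f gradf g \<alpha> \<Delta> y"
  shows "X \<in> edom K g"
    and "u \<in> edom K g \<Longrightarrow>
           \<alpha> * gr X + (\<alpha> *\<^sub>R \<Delta> - gradf y) \<bullet> X + fr X \<le> \<alpha> * gr u + (\<alpha> *\<^sub>R \<Delta> - gradf y) \<bullet> u + fr u"
proof -
  define obj where "obj x = ereal \<alpha> * g x + ereal ((\<alpha> *\<^sub>R \<Delta>) \<bullet> x) + bregman f gradf x y" for x
  define c where "c = gradf y \<bullet> y - fr y"
  let ?l = "\<alpha> *\<^sub>R \<Delta> - gradf y"
  have ef: "y \<in> edom K f"
    by (rule dom_subdiff_edom[OF y])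
  have obj_real: "obj x = ereal (\<alpha> * gr x + ?l \<bullet> x + fr x + c)" if x: "x \<in> edom K g" for x
    using bregman_eq_D[of x y] ef x dom_g
    by (auto simp: obj_def g_eq_gr D_def c_def inner_diff_left inner_diff_right algebra_simps)
  have obj_inf: "obj x = \<infinity>" if x: "x \<in> K" "x \<notin> edom K g" for x
  proof -
    have "g x = \<infinity>"
      using x by (auto simp: edom_def)
    moreover have "bregman f gradf x y \<noteq> -\<infinity>"
      using f_proper x(1) f_eq_fr[OF ef] by (cases "f x") (auto simp: bregman_def proper_on_def)
    ultimately show ?thesis
      using \<alpha>_pos by (simp add: obj_def)
  qed
  have inter: "edom K g \<inter> edom K f = edom K g"
    using dom_g by blast
  obtain m where m: "m \<in> edom K g"
    and m_le: "\<And>u. u \<in> edom K g \<Longrightarrow> \<alpha> * gr m + ?l \<bullet> m + fr m \<le> \<alpha> * gr u + ?l \<bullet> u + fr u"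
    using exists_minimizer[OF g_proper g_convex g_lsc _ \<alpha>_pos y, of x0 ?l] x0
    unfolding inter gr_def by blast
  have "is_arg_min obj (\<lambda>x. x \<in> K) m"
    unfolding is_arg_min_linorder
  proof (intro conjI allI impI)
    show "m \<in> K"
      by (rule edom_subset[OF m])
    fix u assume "u \<in> K"
    then show "obj m \<le> obj u"
      using m_le[of u] obj_real[OF m] obj_real[of u] obj_inf[of u] by (cases "u \<in> edom K g") auto
  qed
  then have "is_arg_min obj (\<lambda>x. x \<in> K) X"
    unfolding X_def prox_step_def arg_min_on_def arg_min_def obj_def[symmetric] by (rule someI)
  then have X: "X \<in> K" "\<And>u. u \<in> K \<Longrightarrow> obj X \<le> obj u"
    by (auto simp: is_arg_min_linorder)
  show XK: "X \<in> edom K g"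
  proof (rule ccontr)
    assume "X \<notin> edom K g"
    then show False
      using X(2)[OF edom_subset[OF m]] obj_inf[OF X(1)] obj_real[OF m] by simp
  qed
  show "\<alpha> * gr X + ?l \<bullet> X + fr X \<le> \<alpha> * gr u + ?l \<bullet> u + fr u" if u: "u \<in> edom K g"
    using X(2)[OF edom_subset[OF u]] by (simp add: obj_real[OF XK] obj_real[OF u])
qed

lemma mirror_mean:
  assumes "\<gamma> *\<^sub>R gradf x + (1 - \<gamma>) *\<^sub>R gradf x' \<in> gradf ` dom_subdiff K f"
  shows "mirror_mean K f gradf \<gamma> x x' \<in> dom_subdiff K f"
    and "gradf (mirror_mean K f gradf \<gamma> x x') = \<gamma> *\<^sub>R gradf x + (1 - \<gamma>) *\<^sub>R gradf x'"
  unfolding mirror_mean_def using inv_into_into[OF assms] f_inv_into_f[OF assms] by auto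

lemma new_point_edom:
  assumes "\<gamma> *\<^sub>R gradf x + (1 - \<gamma>) *\<^sub>R gradf x' \<in> gradf ` dom_subdiff K f"
  shows "new_point B x x' w w' \<in> edom K g"
  unfolding new_point_def by (rule prox_step_minimizes(1)[OF mirror_mean(1)[OF assms]])

lemma new_point_optimality:
  assumes v: "\<gamma> *\<^sub>R gradf x + (1 - \<gamma>) *\<^sub>R gradf x' \<in> gradf ` dom_subdiff K f"
    and B: "length B = b" and X: "X = new_point B x x' w w'" "X \<in> dom_subdiff K f" and u: "u \<in> edom K g"
  shows "0 \<le> \<alpha> * gr u - \<alpha> * gr X
    + (\<alpha> *\<^sub>R (F w + batch_diff B x w') - (\<gamma> *\<^sub>R gradf x + (1 - \<gamma>) *\<^sub>R gradf x') + gradf X) \<bullet> (u - X)"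
proof -
  note y = mirror_mean[OF v]
  have conv: "convex_on (edom K g) (\<lambda>x. \<alpha> * gr x)"
    using edom_convex_on[OF g_proper g_convex K_convex] \<alpha>_pos unfolding gr_def by (intro convex_on_cmul) auto
  let ?l = "\<alpha> *\<^sub>R (F w + batch_diff B x w') - (\<gamma> *\<^sub>R gradf x + (1 - \<gamma>) *\<^sub>R gradf x')"
  have min: "\<alpha> * gr X + ?l \<bullet> X + fr X \<le> \<alpha> * gr z + ?l \<bullet> z + fr z" if "z \<in> edom K g" for z
    using prox_step_minimizes(2)[OF y(1) that, of "F w + batch_diff B x w'"]
    unfolding X(1) new_point_def batch_direction_eq[OF B] y(2) .
  show ?thesis
    using minimizer_variational_inequality[OF conv dom_g _ X(2) u min] new_point_edom[OF v] X(1) by simp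
qed

text \<open>The part of the one-step bound that neither telescopes nor involves \<open>u\<close>. The noise
  \<open>batch_diff B x w' - (F x - F w')\<close> is paired with \<open>u - x\<close>; splitting \<open>u - x\<close> at \<open>x0\<close>
  puts the pairing with \<open>x - x0\<close> here, where it averages to zero.\<close>

definition drift :: "nat list \<Rightarrow> 'a \<Rightarrow> 'a \<Rightarrow> 'a \<Rightarrow> 'a \<Rightarrow> real" where
  "drift B X x x' w' =
     - \<alpha> * ((batch_diff B x w' - (F x - F w')) \<bullet> (x - x0)) - \<alpha> * (batch_diff B x w' \<bullet> (X - x))
     - \<gamma> * D X x - (1 - \<gamma>) * D X x'"

text \<open>The three-point identity for \<open>D\<close> turns the gradients in the optimality condition into Bregman
  distances. The direction used by the step is \<open>F X\<close> up to the error \<open>F X - F w\<close>, which the next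
  step compensates by its own difference \<open>F x - F w'\<close>; hence these terms telescope.\<close>

lemma step_inequality:
  assumes v: "\<gamma> *\<^sub>R gradf x + (1 - \<gamma>) *\<^sub>R gradf x' \<in> gradf ` dom_subdiff K f"
    and B: "length B = b" and X: "X = new_point B x x' w w'" "X \<in> dom_subdiff K f" and u: "u \<in> edom K g"
  shows "\<alpha> * (gr X - gr u + F u \<bullet> (X - u))
    \<le> (D u x + (1 - \<gamma>) * D u x') - (D u X + (1 - \<gamma>) * D u x)
      + \<alpha> * ((F X - F w) \<bullet> (X - u)) - \<alpha> * ((F x - F w') \<bullet> (x - u))
      + \<alpha> * ((batch_diff B x w' - (F x - F w')) \<bullet> (u - x0)) + drift B X x x' w'"
proof -
  have "X \<in> edom K g"
    using new_point_edom[OF v] X(1) by simp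
  then have "0 \<le> (F X - F u) \<bullet> (X - u)"
    using F_monotone u by (simp add: monotone_operator_on_def)
  then have "0 \<le> \<alpha> * ((F X - F u) \<bullet> (X - u))"
    using \<alpha>_pos by simp
  then show ?thesis
    using new_point_optimality[OF assms]
    by (simp add: D_def drift_def inner_diff_left inner_diff_right inner_add_left algebra_simps)
qed

text \<open>For a fixed batch the two proximal problems differ only in the linear term \<open>\<alpha> F w\<close> versus
  \<open>\<alpha> F z\<close>; adding their optimality conditions and using strong monotonicity of the gradient shows
  that the solution depends on that term in a nonexpansive way.\<close>

lemma new_point_contraction:
  assumes v: "\<gamma> *\<^sub>R gradf x + (1 - \<gamma>) *\<^sub>R gradf x' \<in> gradf ` dom_subdiff K f"
    and B: "length B = b"
    and X: "X = new_point B x x' w w'" "X \<in> dom_subdiff K f"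
    and Y: "Y = new_point B x x' z w'" "Y \<in> dom_subdiff K f"
    and wz: "w \<in> edom K g" "z \<in> edom K g"
  shows "N (X - Y) \<le> \<alpha> * L * N (w - z)"
proof (cases "N (X - Y) = 0")
  case False
  have XY: "X \<in> edom K g" "Y \<in> edom K g"
    using new_point_edom[OF v] X(1) Y(1) by simp_all
  have "(N (X - Y))\<^sup>2 \<le> (gradf X - gradf Y) \<bullet> (X - Y)"
    by (rule gradient_strongly_monotone[OF X(2) Y(2)])
  also have "\<dots> \<le> \<alpha> * ((F w - F z) \<bullet> (Y - X))"
    using new_point_optimality[OF v B X XY(2)] new_point_optimality[OF v B Y XY(1)]
    by (simp add: inner_diff_left inner_diff_right inner_add_left algebra_simps)
  also have "\<dots> \<le> \<alpha> * (dual_norm N (F w - F z) * N (Y - X))"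
    using \<alpha>_pos by (intro mult_left_mono inner_le_dual_norm[OF N]) simp
  also have "\<dots> \<le> \<alpha> * (L * N (w - z) * N (Y - X))"
    using \<alpha>_pos by (intro mult_left_mono mult_right_mono F_lipschitzD wz is_norm_nonneg[OF N]) simp
  also have "N (Y - X) = N (X - Y)"
    by (rule is_norm_minus_commute[OF N])
  finally have "N (X - Y) * N (X - Y) \<le> (\<alpha> * L * N (w - z)) * N (X - Y)"
    by (simp add: power2_eq_square algebra_simps)
  moreover have "0 < N (X - Y)"
    using False is_norm_nonneg[OF N, of "X - Y"] by simp
  ultimately show ?thesis
    by (rule mult_right_le_imp_le)
qed (use \<alpha>L is_norm_nonneg[OF N] in simp)

text \<open>What the negative terms of a step leave after \<open>\<theta> D(X, x)\<close> is spent on the cross term and the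
  charge of the following step, whose reference point \<open>w'\<close> is the present \<open>w\<close>, is paid.\<close>

definition surplus :: "'a \<Rightarrow> 'a \<Rightarrow> 'a \<Rightarrow> 'a \<Rightarrow> real" where
  "surplus X x x' w = (\<gamma> - \<theta>) * D X x + (1 - \<gamma>) * D X x' - \<kappa> / 2 * (N (X - w))\<^sup>2"

lemma surplus_ge:
  assumes X: "X \<in> edom K g" and x: "x \<in> dom_subdiff K f" "x' \<in> dom_subdiff K f"
  shows "(1 - \<theta>) / 2 * (p * (N (X - x))\<^sup>2 + (1 - p) * (N (X - x'))\<^sup>2
           - (\<kappa> / (1 - \<theta>)) * (N (X - w))\<^sup>2) \<le> surplus X x x' w"
proof -
  have "X \<in> edom K f"
    using X dom_g by auto
  then have "p * (1 - \<theta>) * ((N (X - x))\<^sup>2 / 2) \<le> p * (1 - \<theta>) * D X x"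
    and "(1 - p) * (1 - \<theta>) * ((N (X - x'))\<^sup>2 / 2) \<le> (1 - p) * (1 - \<theta>) * D X x'"
    using p \<theta>(2) D_ge_half_square x by (auto intro!: mult_left_mono)
  moreover have "(1 - \<theta>) / 2 * (\<kappa> / (1 - \<theta>) * (N (X - w))\<^sup>2) = \<kappa> / 2 * (N (X - w))\<^sup>2"
  proof -
    have "(1 - \<theta>) / 2 * (k * q) = (1 - \<theta>) * k / 2 * q" for k q :: real
      by simp
    moreover have "(1 - \<theta>) * (\<kappa> / (1 - \<theta>)) = \<kappa>"
      using \<theta>(2) by simp
    ultimately show ?thesis
      by (simp only:)
  qed
  moreover have expand: "(1 - \<theta>) / 2 * (p * P + (1 - p) * R - q)
      = p * (1 - \<theta>) * (P / 2) + (1 - p) * (1 - \<theta>) * (R / 2) - (1 - \<theta>) / 2 * q" for P R q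
    by (simp add: field_simps)
  ultimately show ?thesis
    unfolding surplus_def \<theta>(3) \<theta>(4) expand by linarith
qed

lemma \<kappa>_ratio_le: "\<kappa> / (1 - \<theta>) \<le> 3 / 4 - 2 * (\<alpha> * L)\<^sup>2"
  using \<kappa>_le \<theta>(2) by (simp add: pos_divide_le_eq mult.commute)

lemma surplus_nonneg_diagonal:
  assumes X: "X \<in> edom K g" and x: "x \<in> dom_subdiff K f"
  shows "0 \<le> surplus X x x x"
proof -
  have "\<kappa> / (1 - \<theta>) \<le> 1"
    using \<kappa>_ratio_le zero_le_power2[of "\<alpha> * L"] by linarith
  then have "\<kappa> / (1 - \<theta>) * (N (X - x))\<^sup>2 \<le> 1 * (N (X - x))\<^sup>2"
    by (rule mult_right_mono) simp
  then have "0 \<le> (1 - \<theta>) / 2 * (p * (N (X - x))\<^sup>2 + (1 - p) * (N (X - x))\<^sup>2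
           - (\<kappa> / (1 - \<theta>)) * (N (X - x))\<^sup>2)"
    using \<theta>(2) by (intro mult_nonneg_nonneg) (auto simp: algebra_simps)
  then show ?thesis
    using surplus_ge[OF X x x, of x] by linarith
qed

lemma surplus_coin_average_nonneg:
  assumes v: "\<gamma> *\<^sub>R gradf x + (1 - \<gamma>) *\<^sub>R gradf x' \<in> gradf ` dom_subdiff K f"
    and B: "length B = b"
    and x: "x \<in> edom K g" "x \<in> dom_subdiff K f" and x': "x' \<in> edom K g" "x' \<in> dom_subdiff K f"
    and X: "X = new_point B x x' x w'" "X \<in> dom_subdiff K f"
    and Y: "Y = new_point B x x' x' w'" "Y \<in> dom_subdiff K f"
  shows "0 \<le> p * surplus X x x' x + (1 - p) * surplus Y x x' x'"
proof -
  let ?P = "N (X - x)" and ?W = "N (X - x')" and ?U = "N (Y - x)" and ?R = "N (Y - x')"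
    and ?v = "N (x - x')" and ?k = "\<kappa> / (1 - \<theta>)"
  have XY: "X \<in> edom K g" "Y \<in> edom K g"
    using new_point_edom[OF v] X(1) Y(1) by simp_all
  have dist: "N (X - Y) \<le> \<alpha> * L * ?v"
    by (rule new_point_contraction[OF v B X Y x(1) x'(1)])
  note tri = is_norm_triangle_diff[OF N] and sym = is_norm_minus_commute[OF N]
  have "0 \<le> p * (p * ?P\<^sup>2 + (1 - p) * ?W\<^sup>2 - ?k * ?P\<^sup>2) + (1 - p) * (p * ?U\<^sup>2 + (1 - p) * ?R\<^sup>2 - ?k * ?R\<^sup>2)"
  proof (rule coin_average_nonneg[where c = "\<alpha> * L" and v = ?v])
    show "?P \<le> ?U + \<alpha> * L * ?v"
      using tri[of X x Y] dist by simp
    show "?R \<le> ?W + \<alpha> * L * ?v"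
      using tri[of Y x' X] dist sym[of X Y] by simp
    show "?v \<le> ?P + ?W" "?v \<le> ?R + ?U"
      using tri[of x x' X] tri[of x x' Y] sym[of x X] sym[of x Y] by simp_all
    show "?P \<le> ?v + ?W" "?R \<le> ?v + ?U"
      using tri[of X x x'] tri[of Y x' x] sym[of x x'] by simp_all
  qed (use \<alpha>L p \<kappa>_ratio_le is_norm_nonneg[OF N] in auto)
  then have "0 \<le> (1 - \<theta>) / 2 *
      (p * (p * ?P\<^sup>2 + (1 - p) * ?W\<^sup>2 - ?k * ?P\<^sup>2) + (1 - p) * (p * ?U\<^sup>2 + (1 - p) * ?R\<^sup>2 - ?k * ?R\<^sup>2))"
    using \<theta>(2) by (intro mult_nonneg_nonneg) auto
  also have "\<dots> = p * ((1 - \<theta>) / 2 * (p * ?P\<^sup>2 + (1 - p) * ?W\<^sup>2 - ?k * ?P\<^sup>2))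
      + (1 - p) * ((1 - \<theta>) / 2 * (p * ?U\<^sup>2 + (1 - p) * ?R\<^sup>2 - ?k * ?R\<^sup>2))"
    by (simp only: distrib_left mult_ac)
  also have "\<dots> \<le> p * surplus X x x' x + (1 - p) * surplus Y x x' x'"
    using p by (intro add_mono mult_left_mono surplus_ge XY x(2) x'(2)) auto
  finally show ?thesis .
qed

text \<open>Conditional on the past, the noise has mean zero, so its pairing with \<open>x - x0\<close> vanishes on average
  and only its second moment enters the conjugate based at \<open>x0\<close>. The batch difference in the
  conjugate based at \<open>x\<close> has the mean \<open>F x - F w'\<close>, which adds the summand with \<open>L\<^sup>2\<close> to \<open>\<kappa>\<close>.\<close>

lemma expected_step_le:
  assumes x: "x \<in> edom K g" "x \<in> dom_subdiff K f" and w': "w' \<in> edom K g"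
    and x0d: "x0 \<in> dom_subdiff K f"
  defines "\<nu> B \<equiv> batch_diff B x w' - (F x - F w')"
  shows "measure_pmf.expectation (replicate_pmf b (Q x w'))
      (\<lambda>B. \<alpha> * breg_conj x0 (Z + \<nu> B) - \<alpha> * (\<nu> B \<bullet> (x - x0)) + \<theta> * breg_conj x (- (\<alpha> / \<theta>) *\<^sub>R batch_diff B x w'))
    \<le> \<alpha> * breg_conj x0 Z + \<kappa> / 2 * (N (x - w'))\<^sup>2"
proof -
  let ?P = "Q x w'" and ?A = "\<lambda>\<xi>. Fxi \<xi> x - Fxi \<xi> w'" and ?a = "F x - F w'" and ?d = "(N (x - w'))\<^sup>2"
  let ?R = "replicate_pmf b ?P" and ?s = "measure_pmf.expectation (Q x w') (\<lambda>\<xi>. (dual_norm N (Fxi \<xi> x - Fxi \<xi> w'))\<^sup>2)"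
  note fin = oracleD(1)[OF x(1) w'] and mean = oracleD(2)[OF x(1) w'] and var = oracleD(3)[OF x(1) w']
  have finR: "finite (set_pmf ?R)"
    by (rule finite_set_replicate_pmf[OF fin])
  have b0: "0 < real b"
    using b by simp
  have noise: "measure_pmf.expectation ?R (\<lambda>B. breg_conj x0 (Z + \<nu> B)) \<le> breg_conj x0 Z + Lbar\<^sup>2 / real b * ?d / 2"
  proof -
    have "measure_pmf.expectation ?R (\<lambda>B. breg_conj x0 (Z + \<nu> B))
        = measure_pmf.expectation ?R (\<lambda>B. breg_conj x0 ((Z - ?a) + (1 / real b) *\<^sub>R (\<Sum>\<xi>\<leftarrow>B. ?A \<xi>)))"
      by (simp add: \<nu>_def batch_diff_def algebra_simps)
    also have "\<dots> \<le> breg_conj x0 ((Z - ?a) + (1 / real b * real b) *\<^sub>R ?a) + real b * ((1 / real b)\<^sup>2 / 2 * ?s)"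
      by (rule breg_conj_mean_batch[OF fin x0d mean])
    also have "\<dots> = breg_conj x0 Z + ?s / real b / 2"
      using b0 by (simp add: power2_eq_square field_simps)
    also have "\<dots> \<le> breg_conj x0 Z + (Lbar\<^sup>2 * ?d) / real b / 2"
      using var b0 by (simp add: divide_right_mono)
    finally show ?thesis
      by simp
  qed
  have move: "measure_pmf.expectation ?R (\<lambda>B. breg_conj x (- (\<alpha> / \<theta>) *\<^sub>R batch_diff B x w'))
      \<le> (\<alpha> / \<theta>)\<^sup>2 / 2 * ((L\<^sup>2 + Lbar\<^sup>2 / real b) * ?d)"
  proof -
    let ?r = "- (\<alpha> / \<theta>) / real b"
    have "measure_pmf.expectation ?R (\<lambda>B. breg_conj x (- (\<alpha> / \<theta>) *\<^sub>R batch_diff B x w'))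
        = measure_pmf.expectation ?R (\<lambda>B. breg_conj x (0 + ?r *\<^sub>R (\<Sum>\<xi>\<leftarrow>B. ?A \<xi>)))"
      by (simp add: batch_diff_def)
    also have "\<dots> \<le> breg_conj x (0 + (?r * real b) *\<^sub>R ?a) + real b * (?r\<^sup>2 / 2 * ?s)"
      by (rule breg_conj_mean_batch[OF fin x(2) mean])
    also have "(?r * real b) = - (\<alpha> / \<theta>)"
      using b0 by simp
    also have "breg_conj x (0 + (- (\<alpha> / \<theta>)) *\<^sub>R ?a) \<le> (\<alpha> / \<theta>)\<^sup>2 * (dual_norm N ?a)\<^sup>2 / 2"
      using breg_conj_le[OF x(2), of "- (\<alpha> / \<theta>)" ?a] by simp
    also have "(\<alpha> / \<theta>)\<^sup>2 * (dual_norm N ?a)\<^sup>2 / 2 \<le> (\<alpha> / \<theta>)\<^sup>2 * (L\<^sup>2 * ?d) / 2"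
      using power_mono[OF F_lipschitzD[OF x(1) w'] dual_norm_nonneg[OF N], of 2]
      by (intro divide_right_mono mult_left_mono) (auto simp: power_mult_distrib)
    also have "real b * (?r\<^sup>2 / 2 * ?s) = (\<alpha> / \<theta>)\<^sup>2 * (?s / real b) / 2"
      using b0 by (simp add: power2_eq_square)
    also have "(\<alpha> / \<theta>)\<^sup>2 * (?s / real b) / 2 \<le> (\<alpha> / \<theta>)\<^sup>2 * ((Lbar\<^sup>2 * ?d) / real b) / 2"
      using var b0 by (intro divide_right_mono mult_left_mono) auto
    finally show ?thesis
      by (simp add: algebra_simps add_divide_distrib)
  qed
  have zero: "measure_pmf.expectation ?R (\<lambda>B. \<nu> B \<bullet> (x - x0)) = 0"
  proof -
    have "measure_pmf.expectation ?R (\<lambda>B. \<nu> B \<bullet> (x - x0))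
        = measure_pmf.expectation ?R (\<lambda>B. (1 / real b) * (\<Sum>\<xi>\<leftarrow>B. ?A \<xi> \<bullet> (x - x0)) - ?a \<bullet> (x - x0))"
      by (simp add: \<nu>_def batch_diff_def inner_diff_left sum_list_inner)
    also have "\<dots> = (1 / real b) * (real b * measure_pmf.expectation ?P (\<lambda>\<xi>. ?A \<xi> \<bullet> (x - x0))) - ?a \<bullet> (x - x0)"
      by (simp only: expectation_diff_finite[OF finR] integral_mult_right_zero expectation_sum_list_replicate[OF fin])
        simp
    also have "measure_pmf.expectation ?P (\<lambda>\<xi>. ?A \<xi> \<bullet> (x - x0)) = ?a \<bullet> (x - x0)"
      unfolding mean by (rule integral_inner_left) (simp add: integrable_measure_pmf_finite[OF fin])
    finally show ?thesis
      using b0 by simp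
  qed
  have "measure_pmf.expectation ?R
      (\<lambda>B. \<alpha> * breg_conj x0 (Z + \<nu> B) - \<alpha> * (\<nu> B \<bullet> (x - x0)) + \<theta> * breg_conj x (- (\<alpha> / \<theta>) *\<^sub>R batch_diff B x w'))
    = \<alpha> * measure_pmf.expectation ?R (\<lambda>B. breg_conj x0 (Z + \<nu> B)) - \<alpha> * measure_pmf.expectation ?R (\<lambda>B. \<nu> B \<bullet> (x - x0))
      + \<theta> * measure_pmf.expectation ?R (\<lambda>B. breg_conj x (- (\<alpha> / \<theta>) *\<^sub>R batch_diff B x w'))"
    by (simp only: expectation_diff_finite[OF finR] expectation_add_finite[OF finR] integral_mult_right_zero)
  also have "\<dots> \<le> \<alpha> * (breg_conj x0 Z + Lbar\<^sup>2 / real b * ?d / 2) - \<alpha> * 0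
      + \<theta> * ((\<alpha> / \<theta>)\<^sup>2 / 2 * ((L\<^sup>2 + Lbar\<^sup>2 / real b) * ?d))"
    unfolding zero using noise move \<alpha>_pos \<theta>(1) by (intro add_mono diff_mono mult_left_mono) auto
  also have "\<dots> = \<alpha> * breg_conj x0 Z + \<kappa> / 2 * ?d"
    using \<theta>(1) by (simp add: \<kappa>_def power2_eq_square field_simps)
  finally show ?thesis .
qed

end


section \<open>The law of the iterates\<close>

context reflected_method
begin

abbreviation law :: "nat \<Rightarrow> ((int \<Rightarrow> 'a) \<times> (int \<Rightarrow> 'a)) pmf" where
  "law \<equiv> algorithm_law K f gradf g F Fxi Q \<gamma> p \<alpha> b x0"

abbreviation batch_law :: "nat \<Rightarrow> (int \<Rightarrow> 'a) \<times> (int \<Rightarrow> 'a) \<Rightarrow> nat list pmf" where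
  "batch_law s xw \<equiv> replicate_pmf b (Q (fst xw (int s)) (snd xw (int s - 1)))"

definition next_point :: "nat \<Rightarrow> (int \<Rightarrow> 'a) \<times> (int \<Rightarrow> 'a) \<Rightarrow> nat list \<Rightarrow> 'a" where
  "next_point s xw B = new_point B (fst xw (int s)) (fst xw (int s - 1)) (snd xw (int s)) (snd xw (int s - 1))"

definition advance :: "nat \<Rightarrow> (int \<Rightarrow> 'a) \<times> (int \<Rightarrow> 'a) \<Rightarrow> nat list \<Rightarrow> bool \<Rightarrow> (int \<Rightarrow> 'a) \<times> (int \<Rightarrow> 'a)" where
  "advance s xw B coin =
     ((fst xw)(int s + 1 := next_point s xw B),
      (snd xw)(int s + 1 := if coin then next_point s xw B else fst xw (int s)))"

lemma law_Suc:
  "law (Suc s) = bind_pmf (law s) (\<lambda>xw. bind_pmf (batch_law s xw) (\<lambda>B.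
     bind_pmf (bernoulli_pmf p) (\<lambda>coin. return_pmf (advance s xw B coin))))"
  unfolding algorithm_law.simps advance_def next_point_def new_point_def case_prod_beta Let_def by (rule refl)

declare algorithm_law.simps(2) [simp del]

text \<open>The law of the iterates forgets the batches. The state is therefore extended by the accumulated
  noise and the accumulated \<open>drift\<close>.\<close>

definition tracked_step :: "nat \<Rightarrow> ((int \<Rightarrow> 'a) \<times> (int \<Rightarrow> 'a)) \<times> 'a \<times> real \<Rightarrow> nat list \<Rightarrow> bool
    \<Rightarrow> ((int \<Rightarrow> 'a) \<times> (int \<Rightarrow> 'a)) \<times> 'a \<times> real" where
  "tracked_step s st B coin = (case st of (xw, Z, G) \<Rightarrow>
     let x = fst xw (int s); x' = fst xw (int s - 1); w' = snd xw (int s - 1) in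
     (advance s xw B coin, Z + (batch_diff B x w' - (F x - F w')), G + drift B (next_point s xw B) x x' w'))"

primrec tracked_law :: "nat \<Rightarrow> (((int \<Rightarrow> 'a) \<times> (int \<Rightarrow> 'a)) \<times> 'a \<times> real) pmf" where
  "tracked_law 0 = return_pmf ((\<lambda>_. x0, \<lambda>_. x0), 0, 0)"
| "tracked_law (Suc s) = bind_pmf (tracked_law s) (\<lambda>st. bind_pmf (batch_law s (fst st)) (\<lambda>B.
     bind_pmf (bernoulli_pmf p) (\<lambda>coin. return_pmf (tracked_step s st B coin))))"

lemma fst_tracked_step: "fst (tracked_step s st B coin) = advance s (fst st) B coin"
  by (simp add: tracked_step_def case_prod_beta Let_def)

lemma map_fst_tracked_law: "map_pmf fst (tracked_law s) = law s"
proof (induction s)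
  case (Suc s)
  show ?case
    unfolding law_Suc Suc.IH[symmetric]
    by (simp add: map_bind_pmf bind_map_pmf fst_tracked_step)
qed simp

lemma set_law_Suc:
  "xw' \<in> set_pmf (law (Suc s)) \<longleftrightarrow>
     (\<exists>xw\<in>set_pmf (law s). \<exists>B\<in>set_pmf (batch_law s xw). \<exists>coin. xw' = advance s xw B coin)"
  using p unfolding law_Suc by (auto simp: set_pmf_bernoulli)

lemma length_batch: "B \<in> set_pmf (batch_law s xw) \<Longrightarrow> length B = b"
  by (simp add: set_replicate_pmf)

lemma fst_advance: "fst (advance s xw B coin) = (fst xw)(int s + 1 := next_point s xw B)"
  and snd_advance: "snd (advance s xw B coin) = (snd xw)(int s + 1 := if coin then next_point s xw B else fst xw (int s))"
  by (simp_all add: advance_def)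

end

locale reflected_run = reflected_method +
  fixes S :: nat
  assumes well_defined: "iterates_well_defined K f gradf \<gamma> law S"
begin

lemma iterate_dom_subdiff: "s \<le> S \<Longrightarrow> xw \<in> set_pmf (law s) \<Longrightarrow> fst xw (int s) \<in> dom_subdiff K f"
  using well_defined unfolding iterates_well_defined_def by fastforce

lemma mirror_preimage:
  "s < S \<Longrightarrow> xw \<in> set_pmf (law s) \<Longrightarrow>
     \<gamma> *\<^sub>R gradf (fst xw (int s)) + (1 - \<gamma>) *\<^sub>R gradf (fst xw (int s - 1)) \<in> gradf ` dom_subdiff K f"
  using well_defined unfolding iterates_well_defined_def by fastforce

lemma x0_dom_subdiff: "x0 \<in> dom_subdiff K f"
  using iterate_dom_subdiff[of 0 "(\<lambda>_. x0, \<lambda>_. x0)"] by simp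

lemma iterates_in_domain:
  assumes "s \<le> S" "xw \<in> set_pmf (law s)" "r \<le> int s"
  shows "fst xw r \<in> edom K g" "fst xw r \<in> dom_subdiff K f" "snd xw r \<in> edom K g"
proof -
  have "\<forall>r\<le>int s. fst xw r \<in> edom K g \<and> fst xw r \<in> dom_subdiff K f \<and> snd xw r \<in> edom K g"
    using assms(1,2)
  proof (induction s arbitrary: xw)
    case 0
    then show ?case
      using x0 x0_dom_subdiff by simp
  next
    case (Suc s)
    obtain yv B coin where yv: "yv \<in> set_pmf (law s)" "B \<in> set_pmf (batch_law s yv)" "xw = advance s yv B coin"
      using Suc.prems(2) unfolding set_law_Suc by blast
    have IH: "\<forall>r\<le>int s. fst yv r \<in> edom K g \<and> fst yv r \<in> dom_subdiff K f \<and> snd yv r \<in> edom K g"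
      using Suc.IH[OF _ yv(1)] Suc.prems(1) by simp
    have new: "next_point s yv B \<in> edom K g"
      unfolding next_point_def using Suc.prems(1) by (intro new_point_edom mirror_preimage yv(1)) simp
    have new': "next_point s yv B \<in> dom_subdiff K f"
      using iterate_dom_subdiff[OF Suc.prems] unfolding yv(3) fst_advance by simp
    show ?case
    proof (intro allI impI)
      fix r assume "r \<le> int (Suc s)"
      then consider "r \<le> int s" | "r = int s + 1"
        by linarith
      then show "fst xw r \<in> edom K g \<and> fst xw r \<in> dom_subdiff K f \<and> snd xw r \<in> edom K g"
        using IH new new' by cases (auto simp: yv(3) fst_advance snd_advance)
    qed
  qed
  then show "fst xw r \<in> edom K g" "fst xw r \<in> dom_subdiff K f" "snd xw r \<in> edom K g"
    using assms(3) by auto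
qed

lemma next_point_dom_subdiff:
  assumes "s < S" "xw \<in> set_pmf (law s)" "B \<in> set_pmf (batch_law s xw)"
  shows "next_point s xw B \<in> dom_subdiff K f"
proof -
  have "advance s xw B True \<in> set_pmf (law (Suc s))"
    using assms(2,3) unfolding set_law_Suc by blast
  from iterate_dom_subdiff[OF _ this] show ?thesis
    using assms(1) by (simp add: fst_advance)
qed

lemma finite_batch_law:
  assumes "s \<le> S" "xw \<in> set_pmf (law s)"
  shows "finite (set_pmf (batch_law s xw))"
  by (intro finite_set_replicate_pmf oracleD(1) iterates_in_domain[OF assms]) simp_all

lemma tracked_law_fst: "st \<in> set_pmf (tracked_law s) \<Longrightarrow> fst st \<in> set_pmf (law s)"
  by (simp flip: map_fst_tracked_law)

lemma finite_tracked_law: "s \<le> S \<Longrightarrow> finite (set_pmf (tracked_law s))"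
proof (induction s)
  case (Suc s)
  then show ?case
    using finite_batch_law[of s] tracked_law_fst[of _ s] by auto
qed simp

lemma finite_law: "s \<le> S \<Longrightarrow> finite (set_pmf (law s))"
  by (simp add: finite_tracked_law flip: map_fst_tracked_law)

lemma expectation_batch_coin:
  fixes h :: "'c \<Rightarrow> real"
  assumes "finite (set_pmf R)" "\<And>st. st \<in> set_pmf R \<Longrightarrow> finite (set_pmf (T st))"
  shows "measure_pmf.expectation (bind_pmf R (\<lambda>st. bind_pmf (T st)
      (\<lambda>B. bind_pmf (bernoulli_pmf p) (\<lambda>coin. return_pmf (k st B coin))))) h
    = measure_pmf.expectation R (\<lambda>st. measure_pmf.expectation (T st)
        (\<lambda>B. p * h (k st B True) + (1 - p) * h (k st B False)))"
proof -
  have inner: "measure_pmf.expectation (bind_pmf (T st)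
      (\<lambda>B. bind_pmf (bernoulli_pmf p) (\<lambda>coin. return_pmf (k st B coin)))) h
    = measure_pmf.expectation (T st) (\<lambda>B. p * h (k st B True) + (1 - p) * h (k st B False))"
    if "st \<in> set_pmf R" for st
    using assms(2)[OF that] p by (simp add: expectation_bind_finite mult.commute)
  have "measure_pmf.expectation (bind_pmf R (\<lambda>st. bind_pmf (T st)
      (\<lambda>B. bind_pmf (bernoulli_pmf p) (\<lambda>coin. return_pmf (k st B coin))))) h
    = measure_pmf.expectation R (\<lambda>st. measure_pmf.expectation (bind_pmf (T st)
      (\<lambda>B. bind_pmf (bernoulli_pmf p) (\<lambda>coin. return_pmf (k st B coin)))) h)"
    using assms by (intro expectation_bind_finite) auto
  also have "\<dots> = measure_pmf.expectation R (\<lambda>st. measure_pmf.expectation (T st)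
        (\<lambda>B. p * h (k st B True) + (1 - p) * h (k st B False)))"
    by (intro integral_cong_AE) (auto simp: AE_measure_pmf_iff inner)
  finally show ?thesis .
qed

lemma expectation_law_Suc:
  fixes h :: "(int \<Rightarrow> 'a) \<times> (int \<Rightarrow> 'a) \<Rightarrow> real"
  assumes "s < S"
  shows "measure_pmf.expectation (law (Suc s)) h
    = measure_pmf.expectation (law s) (\<lambda>xw. measure_pmf.expectation (batch_law s xw)
        (\<lambda>B. p * h (advance s xw B True) + (1 - p) * h (advance s xw B False)))"
  unfolding law_Suc using assms
  by (intro expectation_batch_coin finite_law finite_batch_law) auto

lemma expectation_tracked_law_Suc:
  fixes h :: "((int \<Rightarrow> 'a) \<times> (int \<Rightarrow> 'a)) \<times> 'a \<times> real \<Rightarrow> real"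
  assumes "s < S"
  shows "measure_pmf.expectation (tracked_law (Suc s)) h
    = measure_pmf.expectation (tracked_law s) (\<lambda>st. measure_pmf.expectation (batch_law s (fst st))
        (\<lambda>B. p * h (tracked_step s st B True) + (1 - p) * h (tracked_step s st B False)))"
  unfolding tracked_law.simps using assms
  by (intro expectation_batch_coin finite_tracked_law finite_batch_law tracked_law_fst) auto

definition step_surplus :: "nat \<Rightarrow> (int \<Rightarrow> 'a) \<times> (int \<Rightarrow> 'a) \<Rightarrow> real" where
  "step_surplus s xw = surplus (fst xw (int s + 1)) (fst xw (int s)) (fst xw (int s - 1)) (snd xw (int s))"

text \<open>The next iterate depends on the coin behind \<open>w\<^sub>s\<close>, so that the two cannot be averaged
  separately. The batch of step \<open>s\<close> does not depend on that coin, hence both outcomes can be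
  compared for the same batch.\<close>

lemma expected_surplus_nonneg:
  assumes "s < S"
  shows "0 \<le> measure_pmf.expectation (law (Suc s)) (step_surplus s)"
proof (cases s)
  case 0
  have "0 \<le> step_surplus 0 xw" if mem: "xw \<in> set_pmf (law (Suc 0))" for xw
  proof -
    obtain yv B coin where "yv \<in> set_pmf (law 0)" "xw = advance 0 yv B coin"
      using mem unfolding set_law_Suc by blast
    then have xw: "xw = advance 0 (\<lambda>_. x0, \<lambda>_. x0) B coin"
      by simp
    have "fst xw 1 \<in> edom K g"
      using iterates_in_domain(1)[OF _ mem, of 1] assms 0 by simp
    then show ?thesis
      using surplus_nonneg_diagonal x0_dom_subdiff
      by (simp add: step_surplus_def xw fst_advance snd_advance)
  qed
  then show ?thesis
    unfolding 0 by (intro integral_nonneg_AE) (auto simp: AE_measure_pmf_iff)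
next
  case (Suc r)
  define H where "H xw = measure_pmf.expectation (batch_law s xw)
    (\<lambda>B. surplus (next_point s xw B) (fst xw (int s)) (fst xw (int s - 1)) (snd xw (int s)))" for xw
  have "step_surplus s (advance s xw B coin)
      = surplus (next_point s xw B) (fst xw (int s)) (fst xw (int s - 1)) (snd xw (int s))" for xw B coin
    by (simp add: step_surplus_def fst_advance snd_advance)
  then have "measure_pmf.expectation (law (Suc s)) (step_surplus s) = measure_pmf.expectation (law s) H"
    unfolding expectation_law_Suc[OF assms] H_def by (simp add: algebra_simps)
  also have "\<dots> = measure_pmf.expectation (law r) (\<lambda>xw. measure_pmf.expectation (batch_law r xw)
        (\<lambda>B. p * H (advance r xw B True) + (1 - p) * H (advance r xw B False)))"
    unfolding Suc using assms Suc by (intro expectation_law_Suc) simp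
  also have "0 \<le> \<dots>"
  proof (intro integral_nonneg_AE AE_pmfI)
    fix xw B assume xw: "xw \<in> set_pmf (law r)" and B: "B \<in> set_pmf (batch_law r xw)"
    define y where "y coin = advance r xw B coin" for coin
    let ?X = "next_point r xw B" and ?x = "fst xw (int r)" and ?w = "snd xw (int r)"
    have y: "y coin \<in> set_pmf (law s)" for coin
      unfolding Suc set_law_Suc y_def using xw B by blast
    have y_simps: "fst (y coin) (int s) = ?X" "fst (y coin) (int s - 1) = ?x" "snd (y coin) (int s - 1) = ?w"
      "snd (y coin) (int s) = (if coin then ?X else ?x)" for coin
      by (simp_all add: y_def Suc fst_advance snd_advance)
    have batch: "batch_law s (y coin) = batch_law s (y True)" for coin
      by (simp add: y_simps)
    have next_eq: "next_point s (y coin) B' = new_point B' ?X ?x (if coin then ?X else ?x) ?w" for coin B'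
      by (simp add: next_point_def y_simps)
    have "finite (set_pmf (batch_law s (y True)))"
      using assms by (intro finite_batch_law y) simp
    then have fin: "finite (set_pmf (replicate_pmf b (Q ?X ?w)))"
      by (simp add: y_simps)
    have "p * H (y True) + (1 - p) * H (y False)
        = measure_pmf.expectation (batch_law s (y True)) (\<lambda>B'.
            p * surplus (new_point B' ?X ?x ?X ?w) ?X ?x ?X + (1 - p) * surplus (new_point B' ?X ?x ?x ?w) ?X ?x ?x)"
      unfolding H_def batch[of False]
      by (simp add: y_simps next_eq expectation_add_finite[OF fin])
    also have "0 \<le> \<dots>"
    proof (intro integral_nonneg_AE AE_pmfI)
      fix B' assume B': "B' \<in> set_pmf (batch_law s (y True))"
      have pre: "\<gamma> *\<^sub>R gradf ?X + (1 - \<gamma>) *\<^sub>R gradf ?x \<in> gradf ` dom_subdiff K f"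
        using mirror_preimage[OF assms y, of True] by (simp add: y_simps)
      have d: "new_point B' ?X ?x (if coin then ?X else ?x) ?w \<in> dom_subdiff K f" for coin
        using next_point_dom_subdiff[OF assms y, of B' coin] B' unfolding batch[of coin] next_eq .
      have X: "?X \<in> edom K g" "?X \<in> dom_subdiff K f"
        using iterates_in_domain[OF _ y, of "int s" True] assms by (simp_all add: y_simps)
      have x: "?x \<in> edom K g" "?x \<in> dom_subdiff K f"
        using iterates_in_domain[OF _ y, of "int s - 1" True] assms by (simp_all add: y_simps)
      show "0 \<le> p * surplus (new_point B' ?X ?x ?X ?w) ?X ?x ?X + (1 - p) * surplus (new_point B' ?X ?x ?x ?w) ?X ?x ?x"
        using surplus_coin_average_nonneg[OF pre length_batch[OF B'] X x refl _ refl] d[of True] d[of False] by simp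
    qed
    finally show "0 \<le> p * H (advance r xw B True) + (1 - p) * H (advance r xw B False)"
      by (simp add: y_def)
  qed
  finally show ?thesis .
qed

text \<open>The part of the accumulated bound that does not depend on \<open>u\<close>, with the pairing of
  \<open>u - x0\<close> and the accumulated noise \<open>Z\<close> replaced by the conjugate at \<open>Z\<close> and with the charge of the coming step included.\<close>

definition potential :: "nat \<Rightarrow> ((int \<Rightarrow> 'a) \<times> (int \<Rightarrow> 'a)) \<times> 'a \<times> real \<Rightarrow> real" where
  "potential s st = (case st of (xw, Z, G) \<Rightarrow>
     \<alpha> * breg_conj x0 Z + G + \<kappa> / 2 * (N (fst xw (int s) - snd xw (int s - 1)))\<^sup>2)"

text \<open>One step replaces the charge \<open>(\<kappa> / 2) \<parallel>x - w'\<parallel>\<^sup>2\<close>, which covers the expected growth of the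
  conjugates, by the charge \<open>(\<kappa> / 2) \<parallel>X - w\<parallel>\<^sup>2\<close>, which the surplus covers.\<close>

lemma potential_step:
  assumes "s < S"
  shows "measure_pmf.expectation (tracked_law (Suc s)) (potential (Suc s))
      \<le> measure_pmf.expectation (tracked_law s) (potential s)"
proof -
  let ?h = "\<lambda>st. potential (Suc s) st + step_surplus s (fst st)"
  have fin: "finite (set_pmf (tracked_law s))" "finite (set_pmf (tracked_law (Suc s)))"
    using assms by (auto intro!: finite_tracked_law simp del: tracked_law.simps)
  have step: "measure_pmf.expectation (batch_law s (fst st))
        (\<lambda>B. p * ?h (tracked_step s st B True) + (1 - p) * ?h (tracked_step s st B False))
    \<le> potential s st" if st: "st \<in> set_pmf (tracked_law s)" for st
  proof -
    obtain xw Z G where st_eq: "st = (xw, Z, G)"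
      by (cases st) auto
    have xw: "xw \<in> set_pmf (law s)"
      using tracked_law_fst[OF st] st_eq by simp
    let ?x = "fst xw (int s)" and ?x' = "fst xw (int s - 1)" and ?w' = "snd xw (int s - 1)"
    note dom = iterates_in_domain[OF less_imp_le[OF assms] xw]
    have finB: "finite (set_pmf (batch_law s xw))"
      using assms by (intro finite_batch_law xw) simp
    define \<nu> where "\<nu> B = batch_diff B ?x ?w' - (F ?x - F ?w')" for B
    have new: "tracked_step s st B coin
        = (advance s xw B coin, Z + \<nu> B, G + drift B (next_point s xw B) ?x ?x' ?w')" for B coin
      by (simp add: tracked_step_def st_eq \<nu>_def Let_def)
    define bound where "bound B = \<alpha> * breg_conj x0 (Z + \<nu> B) - \<alpha> * (\<nu> B \<bullet> (?x - x0))
        + \<theta> * breg_conj ?x (- (\<alpha> / \<theta>) *\<^sub>R batch_diff B ?x ?w')" for B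
    have le: "?h (tracked_step s st B coin) \<le> bound B + G" if B: "B \<in> set_pmf (batch_law s xw)" for B coin
    proof -
      let ?X = "next_point s xw B"
      have "?X \<in> dom_subdiff K f"
        by (rule next_point_dom_subdiff[OF assms xw B])
      then have "(- (\<alpha> / \<theta>) *\<^sub>R batch_diff B ?x ?w') \<bullet> (?X - ?x)
          \<le> breg_conj ?x (- (\<alpha> / \<theta>) *\<^sub>R batch_diff B ?x ?w') + D ?X ?x"
        using dom(2)[of "int s"] by (intro fenchel_young dom_subdiff_edom) auto
      then have "\<theta> * ((- (\<alpha> / \<theta>) *\<^sub>R batch_diff B ?x ?w') \<bullet> (?X - ?x))
          \<le> \<theta> * (breg_conj ?x (- (\<alpha> / \<theta>) *\<^sub>R batch_diff B ?x ?w') + D ?X ?x)"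
        using \<theta>(1) by (intro mult_left_mono) auto
      then have "- \<alpha> * (batch_diff B ?x ?w' \<bullet> (?X - ?x))
          \<le> \<theta> * breg_conj ?x (- (\<alpha> / \<theta>) *\<^sub>R batch_diff B ?x ?w') + \<theta> * D ?X ?x"
        using \<theta>(1) by (simp add: algebra_simps)
      then show ?thesis
        by (simp add: potential_def new step_surplus_def surplus_def bound_def drift_def \<nu>_def
            fst_advance snd_advance algebra_simps)
    qed
    have "measure_pmf.expectation (batch_law s xw) (\<lambda>B. p * ?h (tracked_step s st B True) + (1 - p) * ?h (tracked_step s st B False))
        \<le> measure_pmf.expectation (batch_law s xw) (\<lambda>B. bound B + G)"
    proof (rule expectation_mono_finite[OF finB])
      fix B assume B: "B \<in> set_pmf (batch_law s xw)"
      have "p * ?h (tracked_step s st B True) + (1 - p) * ?h (tracked_step s st B False) \<le> p * (bound B + G) + (1 - p) * (bound B + G)"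
        using p by (intro add_mono mult_left_mono le B) auto
      then show "p * ?h (tracked_step s st B True) + (1 - p) * ?h (tracked_step s st B False) \<le> bound B + G"
        by (simp add: algebra_simps)
    qed
    also have "\<dots> = measure_pmf.expectation (batch_law s xw) bound + G"
      by (simp add: expectation_add_finite finB)
    also have "\<dots> \<le> potential s st"
      using expected_step_le[OF dom(1,2) dom(3) x0_dom_subdiff, of "int s" "int s - 1" Z]
      by (simp add: bound_def[abs_def] \<nu>_def st_eq potential_def)
    finally show ?thesis
      by (simp add: st_eq)
  qed
  have "measure_pmf.expectation (tracked_law (Suc s)) (potential (Suc s))
      + measure_pmf.expectation (law (Suc s)) (step_surplus s)
      = measure_pmf.expectation (tracked_law (Suc s)) ?h"
    using fin(2) by (simp add: expectation_add_finite flip: map_fst_tracked_law del: tracked_law.simps)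
  also have "\<dots> \<le> measure_pmf.expectation (tracked_law s) (potential s)"
    unfolding expectation_tracked_law_Suc[OF assms] by (rule expectation_mono_finite[OF fin(1) step])
  finally show ?thesis
    using expected_surplus_nonneg[OF assms] by linarith
qed

lemma expected_potential_nonpos: "s \<le> S \<Longrightarrow> measure_pmf.expectation (tracked_law s) (potential s) \<le> 0"
proof (induction s)
  case 0
  show ?case
    using breg_conj_le[OF x0_dom_subdiff, of 0 0] \<alpha>_pos
    by (simp add: potential_def is_norm_zero[OF N] mult_nonneg_nonpos)
next
  case (Suc s)
  then show ?case
    using potential_step[of s] by simp
qed

lemma accumulated_inequality:
  assumes "s \<le> S" "st \<in> set_pmf (tracked_law s)" and u: "u \<in> edom K g"
  shows "case st of (xw, Z, G) \<Rightarrow>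
    \<alpha> * (\<Sum>r<s. gr (fst xw (int r + 1)) - gr u + F u \<bullet> (fst xw (int r + 1) - u))
    \<le> (2 - \<gamma>) * D u x0 - (D u (fst xw (int s)) + (1 - \<gamma>) * D u (fst xw (int s - 1)))
      + \<alpha> * ((F (fst xw (int s)) - F (snd xw (int s - 1))) \<bullet> (fst xw (int s) - u))
      + \<alpha> * (Z \<bullet> (u - x0)) + G"
  using assms(1,2)
proof (induction s arbitrary: st)
  case 0
  then show ?case
    by (simp add: algebra_simps)
next
  case (Suc s)
  obtain xw Z G B coin where st: "(xw, Z, G) \<in> set_pmf (tracked_law s)" "B \<in> set_pmf (batch_law s xw)"
    and "st = tracked_step s (xw, Z, G) B coin"
    using Suc.prems(2) by auto
  then have st_eq: "st = (advance s xw B coin,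
          Z + (batch_diff B (fst xw (int s)) (snd xw (int s - 1)) - (F (fst xw (int s)) - F (snd xw (int s - 1)))),
          G + drift B (next_point s xw B) (fst xw (int s)) (fst xw (int s - 1)) (snd xw (int s - 1)))"
    by (simp add: tracked_step_def Let_def)
  have s: "s < S"
    using Suc.prems(1) by simp
  have xw: "xw \<in> set_pmf (law s)"
    using tracked_law_fst[OF st(1)] by simp
  have sum: "(\<Sum>r<s. gr (((fst xw)(int s + 1 := X)) (int r + 1)) - gr u + F u \<bullet> (((fst xw)(int s + 1 := X)) (int r + 1) - u))
      = (\<Sum>r<s. gr (fst xw (int r + 1)) - gr u + F u \<bullet> (fst xw (int r + 1) - u))" for X
    by (intro sum.cong) auto
  show ?case
    using Suc.IH[OF _ st(1)] Suc.prems(1)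
      step_inequality[OF mirror_preimage[OF s xw] length_batch[OF st(2)] next_point_def next_point_dom_subdiff[OF s xw st(2)] u]
    by (simp add: st_eq fst_advance snd_advance sum distrib_left inner_add_left)
qed

text \<open>After the last step one telescoping term \<open>\<alpha> \<langle>F x - F w', x - u\<rangle>\<close> remains. It is split between
  \<open>D(u, x)\<close>, which is left over from the telescoping distances, and the charge for a step that is
  not carried out.\<close>

lemma final_inequality:
  assumes st: "(xw, Z, G) \<in> set_pmf (tracked_law S)" and u: "u \<in> edom K g"
  shows "\<alpha> * (\<Sum>r<S. gr (fst xw (int r + 1)) - gr u + F u \<bullet> (fst xw (int r + 1) - u))
    \<le> (2 + \<alpha> - \<gamma>) * D u x0 + potential S (xw, Z, G)"
proof -
  have xw: "xw \<in> set_pmf (law S)"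
    using tracked_law_fst[OF st] by simp
  note dom = iterates_in_domain[OF order_refl xw]
  let ?x = "fst xw (int S)" and ?x' = "fst xw (int S - 1)" and ?w' = "snd xw (int S - 1)"
  have uf: "u \<in> edom K f"
    using u dom_g by auto
  have "\<alpha> * ((F ?x - F ?w') \<bullet> (?x - u)) \<le> \<alpha>\<^sup>2 * (dual_norm N (F ?x - F ?w'))\<^sup>2 / 2 + (N (?x - u))\<^sup>2 / 2"
    by (rule inner_le_half_squares[OF N])
  moreover have "\<alpha>\<^sup>2 * (dual_norm N (F ?x - F ?w'))\<^sup>2 \<le> \<alpha>\<^sup>2 * (L * N (?x - ?w'))\<^sup>2"
    by (intro mult_left_mono power_mono F_lipschitzD dual_norm_nonneg[OF N] dom) auto
  moreover have "\<alpha>\<^sup>2 * (L * N (?x - ?w'))\<^sup>2 \<le> \<kappa> * (N (?x - ?w'))\<^sup>2"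
    using mult_right_mono[OF \<kappa>_ge, of "(N (?x - ?w'))\<^sup>2"] by (simp add: power_mult_distrib mult_ac)
  moreover have "(N (?x - u))\<^sup>2 / 2 \<le> D u ?x"
    using D_ge_half_square[OF uf dom(2)[of "int S"]] by (simp add: is_norm_minus_commute[OF N, of ?x u])
  moreover have "0 \<le> (1 - \<gamma>) * D u ?x'"
    using \<gamma> D_nonneg[OF uf dom(2)[of "int S - 1"]] by simp
  moreover have "\<alpha> * (Z \<bullet> (u - x0)) \<le> \<alpha> * (breg_conj x0 Z + D u x0)"
    using \<alpha>_pos fenchel_young[OF x0_dom_subdiff uf, of Z] by (intro mult_left_mono) auto
  ultimately show ?thesis
    using accumulated_inequality[OF order_refl st u] by (simp add: potential_def algebra_simps)
qed

lemma average_iterate_in_domain: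
  assumes S: "1 \<le> S" and xw: "xw \<in> set_pmf (law S)"
  shows "average_iterate (fst xw) S \<in> edom K g"
    and "real S * gr (average_iterate (fst xw) S) \<le> (\<Sum>r<S. gr (fst xw (int r + 1)))"
proof -
  let ?y = "\<lambda>r. fst xw (int r + 1)"
  have y: "?y r \<in> edom K g" if "r < S" for r
    using iterates_in_domain(1)[OF order_refl xw, of "int r + 1"] that by simp
  have conv: "convex_on (edom K g) gr"
    using edom_convex_on[OF g_proper g_convex K_convex] by (simp add: gr_def[abs_def])
  have avg: "average_iterate (fst xw) S = (\<Sum>r<S. (1 / real S) *\<^sub>R ?y r)"
    by (simp add: average_iterate_def scaleR_sum_right)
  show "average_iterate (fst xw) S \<in> edom K g"
    unfolding avg using S y by (intro convex_sum[OF _ convex_on_imp_convex[OF conv]]) auto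
  have "gr (average_iterate (fst xw) S) \<le> (\<Sum>r<S. (1 / real S) * gr (?y r))"
    unfolding avg using S y by (intro convex_on_sum[OF _ _ conv]) (auto simp: lessThan_empty_iff)
  then show "real S * gr (average_iterate (fst xw) S) \<le> (\<Sum>r<S. gr (?y r))"
    using S by (simp add: sum_divide_distrib[symmetric] field_simps)
qed

lemma average_inequality:
  assumes S: "1 \<le> S" and st: "(xw, Z, G) \<in> set_pmf (tracked_law S)" and u: "u \<in> edom K g"
  defines "z \<equiv> average_iterate (fst xw) S"
  shows "F u \<bullet> (z - u) + gr z - gr u \<le> ((2 + \<alpha> - \<gamma>) * D u x0 + potential S (xw, Z, G)) / (\<alpha> * real S)"
proof -
  have xw: "xw \<in> set_pmf (law S)"
    using tracked_law_fst[OF st] by simp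
  have "real S *\<^sub>R z = (\<Sum>r<S. fst xw (int r + 1))"
    using S by (simp add: z_def average_iterate_def)
  then have "real S * (F u \<bullet> z) = (\<Sum>r<S. F u \<bullet> fst xw (int r + 1))"
    by (metis inner_scaleR_right inner_sum_right)
  then have "real S * (F u \<bullet> (z - u) + gr z - gr u)
      \<le> (\<Sum>r<S. gr (fst xw (int r + 1)) - gr u + F u \<bullet> (fst xw (int r + 1) - u))"
    using average_iterate_in_domain(2)[OF S xw]
    by (simp add: z_def inner_diff_right sum.distrib sum_subtractf algebra_simps)
  then have "\<alpha> * (real S * (F u \<bullet> (z - u) + gr z - gr u))
      \<le> \<alpha> * (\<Sum>r<S. gr (fst xw (int r + 1)) - gr u + F u \<bullet> (fst xw (int r + 1) - u))"
    using \<alpha>_pos by (intro mult_left_mono) auto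
  also have "\<dots> \<le> (2 + \<alpha> - \<gamma>) * D u x0 + potential S (xw, Z, G)"
    by (rule final_inequality[OF st u])
  finally show ?thesis
    using S \<alpha>_pos by (simp add: pos_le_divide_eq mult_ac)
qed

end


section \<open>The gap function\<close>

context reflected_method
begin

lemma Gap_eq:
  assumes "z \<in> edom K g"
  shows "Gap K g F C z = (SUP u\<in>C \<inter> edom K g. ereal (F u \<bullet> (z - u) + gr z - gr u))"
  unfolding Gap_def by (intro SUP_cong) (auto simp: g_eq_gr assms)

text \<open>Monotonicity replaces \<open>F u\<close> by \<open>F z\<close>, which is fixed, and \<open>g\<close> is bounded below on the compact
  set \<open>C\<close>.\<close>

lemma Gap_finite:
  assumes z: "z \<in> edom K g" and C: "compact C" "C \<subseteq> K" "C \<inter> edom K g \<noteq> {}"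
  shows "\<bar>Gap K g F C z\<bar> \<noteq> \<infinity>"
proof -
  obtain m where m: "\<And>u. u \<in> C \<Longrightarrow> ereal m \<le> g u"
    using lsc_bounded_below_on_compact[OF C(1) lsc_at_points_subset[OF lsc_on_imp_lsc_at_points[OF g_lsc] C(2)]]
      g_proper C(2) by (metis proper_on_def subsetD)
  obtain R where R: "\<And>u. u \<in> C \<Longrightarrow> norm u \<le> R"
    using compact_imp_bounded[OF C(1)] unfolding bounded_iff by blast
  let ?M = "norm (F z) * (norm z + R) + gr z - m"
  have le: "F u \<bullet> (z - u) + gr z - gr u \<le> ?M" if u: "u \<in> C" "u \<in> edom K g" for u
  proof -
    have "0 \<le> (F z - F u) \<bullet> (z - u)"
      using F_monotone z u(2) by (simp add: monotone_operator_on_def)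
    then have "F u \<bullet> (z - u) \<le> F z \<bullet> (z - u)"
      by (simp add: inner_diff_left)
    also have "\<dots> \<le> norm (F z) * norm (z - u)"
      by (rule norm_cauchy_schwarz)
    also have "\<dots> \<le> norm (F z) * (norm z + R)"
      using norm_triangle_ineq4[of z u] R[OF u(1)] by (intro mult_left_mono) auto
    finally show ?thesis
      using m[OF u(1)] g_eq_gr[OF u(2)] by simp
  qed
  have "Gap K g F C z \<le> ereal ?M"
    unfolding Gap_eq[OF z] using le by (intro SUP_least) auto
  moreover obtain u where u: "u \<in> C \<inter> edom K g"
    using C(3) by blast
  have "ereal (F u \<bullet> (z - u) + gr z - gr u) \<le> Gap K g F C z"
    unfolding Gap_eq[OF z] by (rule SUP_upper[OF u])
  ultimately show ?thesis
    by (cases "Gap K g F C z") auto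
qed

end

context reflected_run
begin

lemma expected_gap_le:
  assumes S: "1 \<le> S" and C: "compact C" "C \<subseteq> K" "C \<inter> edom K g \<noteq> {}"
    and m: "\<And>u. u \<in> C \<inter> edom K g \<Longrightarrow> D u x0 \<le> m"
  shows "measure_pmf.expectation (law S) (\<lambda>(x, w). real_of_ereal (Gap K g F C (average_iterate x S)))
    \<le> (2 + \<alpha> - \<gamma>) / (\<alpha> * real S) * m"
proof -
  let ?gap = "\<lambda>xw. real_of_ereal (Gap K g F C (average_iterate (fst xw) S))"
  let ?c = "\<alpha> * real S"
  have c: "0 < ?c"
    using S \<alpha>_pos by simp
  have fin: "finite (set_pmf (tracked_law S))"
    by (rule finite_tracked_law) simp
  have le: "?gap (fst st) \<le> (2 + \<alpha> - \<gamma>) / ?c * m + potential S st / ?c" if st: "st \<in> set_pmf (tracked_law S)" for st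
  proof -
    obtain xw Z G where st_eq: "st = (xw, Z, G)"
      by (cases st) auto
    have xw: "xw \<in> set_pmf (law S)"
      using tracked_law_fst[OF st] st_eq by simp
    note z = average_iterate_in_domain(1)[OF S xw]
    have "Gap K g F C (average_iterate (fst xw) S) \<le> ereal (((2 + \<alpha> - \<gamma>) * m + potential S st) / ?c)"
      unfolding Gap_eq[OF z]
    proof (rule SUP_least)
      fix u assume u: "u \<in> C \<inter> edom K g"
      have "(2 + \<alpha> - \<gamma>) * D u x0 \<le> (2 + \<alpha> - \<gamma>) * m"
        using m[OF u] \<alpha>_pos \<gamma> by (intro mult_left_mono) auto
      then have "((2 + \<alpha> - \<gamma>) * D u x0 + potential S st) / ?c \<le> ((2 + \<alpha> - \<gamma>) * m + potential S st) / ?c"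
        using c by (intro divide_right_mono) auto
      then show "ereal (F u \<bullet> (average_iterate (fst xw) S - u) + gr (average_iterate (fst xw) S) - gr u)
          \<le> ereal (((2 + \<alpha> - \<gamma>) * m + potential S st) / ?c)"
        using average_inequality[OF S st[unfolded st_eq], of u] u by (simp add: st_eq)
    qed
    then show ?thesis
      using Gap_finite[OF z C] unfolding st_eq
      by (cases "Gap K g F C (average_iterate (fst xw) S)") (auto simp: add_divide_distrib)
  qed
  have "measure_pmf.expectation (law S) ?gap = measure_pmf.expectation (tracked_law S) (\<lambda>st. ?gap (fst st))"
    by (simp flip: map_fst_tracked_law)
  also have "\<dots> \<le> measure_pmf.expectation (tracked_law S) (\<lambda>st. (2 + \<alpha> - \<gamma>) / ?c * m + potential S st / ?c)"
    by (rule expectation_mono_finite[OF fin le])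
  also have "\<dots> = (2 + \<alpha> - \<gamma>) / ?c * m + measure_pmf.expectation (tracked_law S) (potential S) / ?c"
    by (simp add: expectation_add_finite fin)
  also have "\<dots> \<le> (2 + \<alpha> - \<gamma>) / ?c * m"
    using expected_potential_nonpos[OF order_refl] c by (simp add: divide_nonpos_pos)
  finally show ?thesis
    unfolding case_prod_beta .
qed

end


section \<open>The rate of convergence\<close>

theorem theorem3p3:
  fixes K C :: "'a::euclidean_space set"
    and N :: "'a \<Rightarrow> real"
    and f g :: "'a \<Rightarrow> ereal"
    and gradf F :: "'a \<Rightarrow> 'a"
    and Fi Fxi :: "nat \<Rightarrow> 'a \<Rightarrow> 'a"
    and Q :: "'a \<Rightarrow> 'a \<Rightarrow> nat pmf"
    and \<gamma> p \<alpha> L Lbar :: real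
    and M b S :: nat
    and x0 :: 'a
  defines "law \<equiv> algorithm_law K f gradf g F Fxi Q \<gamma> p \<alpha> b x0"
  assumes "is_norm N"
    and "K \<noteq> {}" "closed K" "convex K"
    and "proper_on K g" "ereal_convex_on K g" "lsc_on K g"
    and "1 \<le> M" "\<forall>x\<in>edom K g. F x = (1 / real M) *\<^sub>R (\<Sum>i\<in>{1..M}. Fi i x)"
    and "proper_on K f" "ereal_convex_on K f" "lsc_on K f"
    and "edom K g \<subseteq> edom K f"
    and "gradient_on K f gradf (dom_subdiff K f)"
    and "strongly_convex1 N K f gradf"
    and A1: "vi_solutions K g F \<noteq> {}"
    and A2: "monotone_operator_on (edom K g) F"
    and A3: "0 \<le> Lbar" "variable_lipschitz_oracle N Lbar (edom K g) M F Fxi Q"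
    and A4: "0 \<le> L" "operator_lipschitz_on N L (edom K g) F"
    and "0 < p" "p < 1" "p < \<gamma>" "\<gamma> < 1" "0 < \<alpha>" "1 \<le> b" "b \<le> M"
    and "\<alpha> \<le> min ((\<gamma> - p) / (2 * (1 - p)))
                  ((1 - \<gamma>) * real b / ((1 - p) * (2 * Lbar\<^sup>2 + real b * L\<^sup>2)))"
    and "x0 \<in> edom K g"
    and "1 \<le> S"
    and "iterates_well_defined K f gradf \<gamma> law S"
    and "compact C" "C \<subseteq> K" "C \<inter> edom K g \<noteq> {}"
  shows "(\<forall>(x, w)\<in>set_pmf (law S). \<bar>Gap K g F C (average_iterate x S)\<bar> \<noteq> \<infinity>) \<and>
         ereal (measure_pmf.expectation (law S)
                  (\<lambda>(x, w). real_of_ereal (Gap K g F C (average_iterate x S))))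
           \<le> ereal ((2 + \<alpha> - \<gamma>) / (\<alpha> * real S)) * (SUP u\<in>C \<inter> edom K g. bregman f gradf u x0)"
proof -
  interpret reflected_run K N f gradf g F Fxi Q \<gamma> p \<alpha> L Lbar M b x0 S
    by unfold_locales (use assms in \<open>simp_all add: law_def\<close>)
  let ?c = "(2 + \<alpha> - \<gamma>) / (\<alpha> * real S)"
  let ?gap = "\<lambda>(x, w). real_of_ereal (Gap K g F C (average_iterate x S))"
  let ?sup = "SUP u\<in>C \<inter> edom K g. bregman f gradf u x0"
  have c: "0 < ?c"
    using \<open>0 < \<alpha>\<close> \<open>\<gamma> < 1\<close> \<open>1 \<le> S\<close> by simp
  have D: "bregman f gradf u x0 = ereal (D u x0)" "0 \<le> D u x0" if "u \<in> C \<inter> edom K g" for u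
    using that dom_g bregman_eq_D[of u x0] D_nonneg[OF _ x0_dom_subdiff, of u] dom_subdiff_edom[OF x0_dom_subdiff]
    by auto
  obtain u0 where u0: "u0 \<in> C \<inter> edom K g"
    using \<open>C \<inter> edom K g \<noteq> {}\<close> by blast
  have sup_nonneg: "0 \<le> ?sup"
    using D[OF u0] by (intro SUP_upper2[OF u0]) simp
  have "ereal (measure_pmf.expectation (law S) ?gap) \<le> ereal ?c * ?sup"
  proof (cases ?sup)
    case (real m)
    have "D u x0 \<le> m" if u: "u \<in> C \<inter> edom K g" for u
      using SUP_upper[OF u, of "\<lambda>u. bregman f gradf u x0"] real D(1)[OF u] by simp
    then have "measure_pmf.expectation (law S) ?gap \<le> ?c * m"
      unfolding law_def
      by (rule expected_gap_le[OF \<open>1 \<le> S\<close> \<open>compact C\<close> \<open>C \<subseteq> K\<close> \<open>C \<inter> edom K g \<noteq> {}\<close>])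
    then show ?thesis
      using real by simp
  next
    case PInf
    have "ereal r * \<infinity> = \<infinity>" if "0 < r" for r :: real
      using that by simp
    then show ?thesis
      unfolding PInf using c by (metis ereal_less_eq(1))
  next
    case MInf
    then show ?thesis
      using sup_nonneg by simp
  qed
  moreover have "\<forall>(x, w)\<in>set_pmf (law S). \<bar>Gap K g F C (average_iterate x S)\<bar> \<noteq> \<infinity>"
  proof (rule ballI)
    fix xw assume "xw \<in> set_pmf (law S)"
    then have "average_iterate (fst xw) S \<in> edom K g"
      unfolding law_def by (rule average_iterate_in_domain(1)[OF \<open>1 \<le> S\<close>])
    then show "case xw of (x, w) \<Rightarrow> \<bar>Gap K g F C (average_iterate x S)\<bar> \<noteq> \<infinity>"
      unfolding case_prod_beta
      by (rule Gap_finite[OF _ \<open>compact C\<close> \<open>C \<subseteq> K\<close> \<open>C \<inter> edom K g \<noteq> {}\<close>])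
  qed
  ultimately show ?thesis
    by blast
qed

end
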